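(* Let $n\ge1$ and let $A$ be a set of injective words over $\overline{\mathbb{Z}}$, all of length $n-1$ and with all letters having values in $[n]$, such that $A$ is stable under $\equiv$. Then $$\mathrm{DS}_n\Big(\sum_{W\in A}\mathfrak{F}(W)\Big)=\#\{W\in A: W\text{ is an }\Omega\text{-parking word}\}.$$
   Context: $\overline{\mathbb{Z}}$ is the set of symbols $(i,j)$, $i\in\mathbb{Z}$, $j\ge1$, totally ordered lexicographically, with $\mathrm{val}(i,j)=i$. A word is injective if its letters are distinct. For an injective word $W=W_1\cdots W_k$, the slide polynomial $\mathfrak{F}(W)=\sum x_{a_1}\cdots x_{a_k}$ is taken over integer sequences $a_1\ge\cdots\ge a_k\ge1$ with $a_j\le\mathrm{val}(W_j)$ and $a_j>a_{j+1}$ whenever $W_j>W_{j+1}$. For $f$ homogeneous of degree $n-1$ in $x_1,\dots,x_n$, $\mathrm{DS}_n(f)=\sum_{w\in S_n}w\cdot\big(f/\prod_{i=1}^{n-1}(x_i-x_{i+1})\big)\in\mathbb{Q}$, with $S_n$ permuting the variables. Indexed forests: for finite $S\subset\mathbb{Z}$ with maximal consecutive blocks $I_1<\cdots<I_k$, an indexed forest with support $S$ consists of plane binary trees $T_j$ with $|I_j|$ nodes canonically labeled by $I_j$ in inorder. $\mathrm{INT}(u,F)$ is the set of canonical labels under $u$. $\mathsf{LBS}(F)$ is the set of injective $\rho:\operatorname{IN}(F)\to\overline{\mathbb{Z}}$ with $\rho(\text{left child of }u)<\rho(u)<\rho(\text{right child of }u)$ and $\mathrm{val}(\rho(u))\in\mathrm{INT}(u,F)$.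 Insertion $W\mapsto P(W)$: for $W$ empty, $P$ is the empty forest. For $W=W'a$, let $F'$ be the forest of $P(W')$, with blocks $I_1<\cdots<I_k$, roots $u_j$ and root labels $a_j$, and let $i=\mathrm{val}(a)$. Add a new root $u$ labeled $a$ as follows. (i) If $i\notin\mathrm{Supp}(F')$: $u$ has canonical label $i$, left child $u_j$ if $i-1\in I_j$, and right child $u_{j'}$ if $i+1\in I_{j'}$ (else no such child). (ii) If $i\in I_j$ and $a>a_j$: the left child is $u_j$, the right child is $u_{j+1}$ if $\max I_j+2\in\mathrm{Supp}(F')$, and $\max I_j+1$ is added to the support. (iii) If $i\in I_j$ and $a<a_j$: the right child is $u_j$, the left child is $u_{j-1}$ if $\min I_j-2\in\mathrm{Supp}(F')$, and $\min I_j-1$ is added to the support. $W\equiv W'$ means $P(W)=P(W')$. $\Omega$-parking: $\Omega(\text{empty})=\emptyset$. For $W=W'a$: if $\mathrm{val}(a)\notin\Omega(W')$, set $\Omega(W)=\Omega(W')\cup\{\mathrm{val}(a)\}$. Otherwise $\mathrm{val}(a)$ lies in a maximal interval $I$ of $\Omega(W')$; let $W_i$ be the last letter of $W'$ with $\mathrm{val}(W_i)\in I$, and add $\min I-1$ if $a<W_i$ or $\max I+1$ if $a>W_i$. $W$ is an $\Omega$-parking word if $\Omega(W)=\{1,\dots,|W|\}$.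
   Formalization: The set A is assumed finite, since there are infinitely many letters of each value and for infinite A (e.g. n=2, A={(1,j): j≥1}) the sum of slide polynomials is not defined; stability under ≡ is required among injective words. *)

theory Defs
  imports
    Complex_Main
    "HOL-Library.Poly_Mapping"
    "HOL-Library.Tree"
    "HOL-Combinatorics.Permutations"
    "HOL-Computational_Algebra.Fraction_Field"
begin

subsection \<open>Letters\<close>

typedef zbar = "{p :: int \<times> nat. 1 \<le> snd p}"
  by (rule exI[of _ "(0, 1)"]) simp

definition val :: "zbar \<Rightarrow> int" where
  "val a = fst (Rep_zbar a)"

definition idx :: "zbar \<Rightarrow> nat" where
  "idx a = snd (Rep_zbar a)"

lemma zbar_eq_iff: "a = b \<longleftrightarrow> val a = val b \<and> idx a = idx b"
  by (auto simp: val_def idx_def prod_eq_iff simp flip: Rep_zbar_inject)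

instantiation zbar :: linorder
begin

definition less_eq_zbar :: "zbar \<Rightarrow> zbar \<Rightarrow> bool" where
  "a \<le> b \<longleftrightarrow> val a < val b \<or> (val a = val b \<and> idx a \<le> idx b)"

definition less_zbar :: "zbar \<Rightarrow> zbar \<Rightarrow> bool" where
  "a < b \<longleftrightarrow> val a < val b \<or> (val a = val b \<and> idx a < idx b)"

instance
  by intro_classes (auto simp: less_eq_zbar_def less_zbar_def zbar_eq_iff)

end


subsection \<open>Polynomials and slide polynomials\<close>

text \<open>Finitely supported exponent vectors, with finitely many rational coefficients:
  the polynomial ring over the rationals in the variables \<open>x\<^sub>i\<close>, \<open>i :: nat\<close>.\<close>

type_synonym ratpoly = "(nat \<Rightarrow>\<^sub>0 nat) \<Rightarrow>\<^sub>0 rat"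

definition Xvar :: "nat \<Rightarrow> ratpoly" where
  "Xvar i = Poly_Mapping.single (Poly_Mapping.single i 1) 1"

definition slide_seqs :: "zbar list \<Rightarrow> nat list set" where
  "slide_seqs W = {a. length a = length W \<and>
     (\<forall>j < length W. 1 \<le> a ! j \<and> int (a ! j) \<le> val (W ! j)) \<and>
     (\<forall>j. Suc j < length W \<longrightarrow> a ! j \<ge> a ! Suc j) \<and>
     (\<forall>j. Suc j < length W \<longrightarrow> W ! j > W ! Suc j \<longrightarrow> a ! j > a ! Suc j)}"

lemma finite_slide_seqs: "finite (slide_seqs W)"
proof (rule finite_subset)
  let ?N = "Max (insert 0 ((\<lambda>b. nat (val b)) ` set W))"
  show "slide_seqs W \<subseteq> {a. set a \<subseteq> {..?N} \<and> length a = length W}"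
  proof (intro subsetI CollectI conjI)
    fix a x assume a: "a \<in> slide_seqs W" and "x \<in> set a"
    then obtain j where j: "j < length W" "x = a ! j"
      by (auto simp: slide_seqs_def in_set_conv_nth)
    then have "x \<le> nat (val (W ! j))"
      using a by (auto simp: slide_seqs_def le_nat_iff nat_le_eq_zle)
    also have "\<dots> \<le> ?N"
      using j by (intro Max_ge) auto
    finally show "x \<in> {..?N}" by simp
  qed (auto simp: slide_seqs_def)
  show "finite {a. set a \<subseteq> {..?N} \<and> length a = length W}"
    by (rule finite_lists_length_eq) simp
qed

definition slide :: "zbar list \<Rightarrow> ratpoly" where
  "slide W = (\<Sum>a\<in>slide_seqs W. \<Prod>j<length W. Xvar (a ! j))"


subsection \<open>Divided symmetrization\<close>

text \<open>Substitution of \<open>x\<^bsub>w i\<^esub>\<close> for \<open>x\<^sub>i\<close>.\<close>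

definition act :: "(nat \<Rightarrow> nat) \<Rightarrow> ratpoly \<Rightarrow> ratpoly" where
  "act w f = (\<Sum>m\<in>Poly_Mapping.keys f. Poly_Mapping.single 0 (Poly_Mapping.lookup f m) *
     (\<Prod>i\<in>Poly_Mapping.keys m. Xvar (w i) ^ Poly_Mapping.lookup m i))"

lemma act_Xvar [simp]: "act w (Xvar i) = Xvar (w i)"
  by (simp add: act_def Xvar_def flip: single_one)

text \<open>The sum is formed in the field of rational functions. For \<open>f\<close> homogeneous of degree
  \<open>n - 1\<close> in \<open>x\<^sub>1, \<dots>, x\<^sub>n\<close> its value is a constant, i.e. it lies in the
  copy of the rationals inside that field.\<close>

definition DS :: "nat \<Rightarrow> ratpoly \<Rightarrow> ratpoly fract" where
  "DS n f = (\<Sum>w | w permutes {1..n}.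
     Fract (act w f) (act w (\<Prod>i = 1..n - 1. Xvar i - Xvar (i + 1))))"


subsection \<open>Labeled indexed forests and insertion\<close>

text \<open>A labeled indexed forest is the set of its (nonempty) trees. Every node carries the pair
  of its canonical label and its letter; the canonical labels of a tree are those of its block
  in inorder, and so equality of such sets is equality of the indexed forests together with
  their labelings.\<close>

type_synonym lforest = "(int \<times> zbar) tree set"

definition tree_supp :: "(int \<times> zbar) tree \<Rightarrow> int set" where
  "tree_supp T = fst ` set_tree T"

definition Supp :: "lforest \<Rightarrow> int set" where
  "Supp F = (\<Union>T\<in>F. tree_supp T)"

fun root_letter :: "(int \<times> zbar) tree \<Rightarrow> zbar" where
  "root_letter (Node l (c, a) r) = a"
| "root_letter Leaf = undefined"

text \<open>The tree whose block contains \<open>i\<close>; it is \<open>Leaf\<close>, giving an absent child,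
  if \<open>i\<close> is not in the support.\<close>

definition tree_at :: "lforest \<Rightarrow> int \<Rightarrow> (int \<times> zbar) tree" where
  "tree_at F i = (if i \<in> Supp F then THE T. T \<in> F \<and> i \<in> tree_supp T else Leaf)"

text \<open>A new root with canonical label \<open>c\<close> and letter \<open>a\<close> above the trees
  \<open>L\<close> and \<open>R\<close> of \<open>F\<close>.\<close>

definition graft :: "lforest \<Rightarrow> (int \<times> zbar) tree \<Rightarrow> int \<Rightarrow> zbar \<Rightarrow> (int \<times> zbar) tree \<Rightarrow> lforest" where
  "graft F L c a R = insert (Node L (c, a) R) (F - {L, R})"

definition insert_letter :: "lforest \<Rightarrow> zbar \<Rightarrow> lforest" where
  "insert_letter F a =
    (let i = val a; T = tree_at F i; I = tree_supp T in
     if i \<notin> Supp F then graft F (tree_at F (i - 1)) i a (tree_at F (i + 1))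
     else if a > root_letter T then graft F T (Max I + 1) a (tree_at F (Max I + 2))
     else graft F (tree_at F (Min I - 2)) (Min I - 1) a T)"

definition P_forest :: "zbar list \<Rightarrow> lforest" where
  "P_forest W = foldl insert_letter {} W"

definition word_equiv :: "zbar list \<Rightarrow> zbar list \<Rightarrow> bool" where
  "word_equiv W W' \<longleftrightarrow> P_forest W = P_forest W'"


subsection \<open>Parking words\<close>

text \<open>For \<open>i \<in> S\<close>, the maximal interval of \<open>S\<close> containing \<open>i\<close>.\<close>

definition max_interval :: "int set \<Rightarrow> int \<Rightarrow> int set" where
  "max_interval S i = {j. {min i j..max i j} \<subseteq> S}"

fun Omega :: "zbar list \<Rightarrow> int set" where
  "Omega W = (if W = [] then {} else
    (let W' = butlast W; a = last W; S = Omega W' in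
     if val a \<notin> S then insert (val a) S
     else
       (let I = max_interval S (val a); b = last (filter (\<lambda>b. val b \<in> I) W') in
        if a < b then insert (Min I - 1) S else insert (Max I + 1) S)))"

declare Omega.simps [simp del]

lemma Omega_Nil [simp]: "Omega [] = {}"
  by (simp add: Omega.simps)

lemma Omega_snoc:
  "Omega (W @ [a]) =
    (let S = Omega W; I = max_interval S (val a); b = last (filter (\<lambda>b. val b \<in> I) W) in
     if val a \<notin> S then insert (val a) S
     else if a < b then insert (Min I - 1) S else insert (Max I + 1) S)"
  by (subst Omega.simps) (simp add: Let_def)

definition Omega_parking :: "zbar list \<Rightarrow> bool" where
  "Omega_parking W \<longleftrightarrow> Omega W = {1..int (length W)}"

end

theory Submission
  imports Defs
    "HOL-Combinatorics.Multiset_Permutations"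
    "HOL-Library.Product_Lexorder"
begin

text \<open>
  Insertion identifies the words \<open>W'\<close> with \<open>P(W') = P(W)\<close> with the linear extensions of the forest
  \<open>F\<close> of \<open>P(W)\<close>, whose support is \<open>\<Omega>(W)\<close>. Hence, by the theory of \<open>P\<close>-partitions, the slide
  polynomials of a class add up to the generating function of the fillings \<open>f\<close> of \<open>F\<close> with
  \<open>1 \<le> f(u) \<le> min INT(u)\<close> that increase weakly towards left and strictly towards right descendants.

  Divided symmetrization of a polynomial of degree \<open>n - 1\<close> is a constant, so it may be evaluated at
  \<open>x\<^sub>n = 0\<close>. This yields \<open>DS\<^sub>n(g) = \<Sum>\<^sub>i DS\<^sub>n\<^sub>-\<^sub>1(T\<^sub>i g)\<close>, where \<open>T\<^sub>i g\<close> is the quotient by \<open>x\<^sub>i\<close> of the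
  difference of \<open>g\<close> with \<open>0\<close> inserted at the places \<open>i + 1\<close> and \<open>i\<close>. The operator \<open>T\<^sub>i\<close> maps the
  generating function of \<open>F\<close> to that of \<open>F\<close> without the node labeled \<open>i\<close> if this node is a leaf, and
  to \<open>0\<close> otherwise. By induction \<open>DS\<^sub>n\<close> counts the linear extensions of \<open>F\<close> if its support is
  \<open>{1..n-1}\<close>, and it vanishes for every other support.
\<close>

subsection \<open>Divided symmetrization over a finite subset of a field\<close>

text \<open>Setting a variable to \<open>0\<close> is not defined on the whole field of rational
  functions, so the symmetrization is taken over an arbitrary finite set \<open>X\<close> of field
  elements, a polynomial being just a function of its coordinates. That its value is a constant then
  means that all sets \<open>X\<close> of the same size give the same value, and the variables may
  be exchanged for a set containing \<open>0\<close>. An infinite field supplies such sets in every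
  size. The bound \<open>min INT(u)\<close> is what makes the induction close. The words themselves
  only give the bound by the value of the letter at \<open>u\<close>; trading it for the left end of
  the interval removes the labeling from the problem, and the fillings left after a leaf is removed
  are bounded by the left ends of the shrunken intervals again, so they belong to a forest of the
  same kind. For the same reason a forest is kept as a set of nodes with labels and intervals, not
  as trees: removing a leaf in the middle then only deletes one node and renumbers the rest.\<close>

fun diff_prod :: "'a::field list \<Rightarrow> 'a" where
  "diff_prod (x # y # zs) = (x - y) * diff_prod (y # zs)"
| "diff_prod _ = 1"

text \<open>Coordinates are numbered from \<open>1\<close>.\<close>

definition coord :: "'a list \<Rightarrow> nat \<Rightarrow> 'a" where
  "coord xs j = xs ! (j - 1)"

definition dsym :: "'a::field set \<Rightarrow> ((nat \<Rightarrow> 'a) \<Rightarrow> 'a) \<Rightarrow> 'a" where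
  "dsym X g = (\<Sum>xs\<in>permutations_of_set X. g (coord xs) / diff_prod xs)"

definition ins_zero :: "nat \<Rightarrow> (nat \<Rightarrow> 'a::zero) \<Rightarrow> nat \<Rightarrow> 'a" where
  "ins_zero i z j = (if j < i then z j else if j = i then 0 else z (j - 1))"

definition trim :: "nat \<Rightarrow> ((nat \<Rightarrow> 'a::field) \<Rightarrow> 'a) \<Rightarrow> (nat \<Rightarrow> 'a) \<Rightarrow> 'a" where
  "trim i g z = (g (ins_zero (Suc i) z) - g (ins_zero i z)) / z i"

text \<open>A monomial is a list of indices with repetition: its degree is the length, and
  cancelling one factor is \<open>remove1\<close>.\<close>

definition monom_at :: "nat list \<Rightarrow> (nat \<Rightarrow> 'a::field) \<Rightarrow> 'a" where
  "monom_at a z = prod_list (map z a)"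

lemma dsym_add: "dsym X (\<lambda>z. f z + g z) = dsym X f + dsym X g"
  by (simp add: dsym_def add_divide_distrib sum.distrib)

lemma dsym_cmult: "dsym X (\<lambda>z. c * g z) = c * dsym X g"
  by (simp add: dsym_def sum_distrib_left)

lemma dsym_sum: "dsym X (\<lambda>z. \<Sum>i\<in>I. g i z) = (\<Sum>i\<in>I. dsym X (g i))"
  unfolding dsym_def sum_divide_distrib by (rule sum.swap)

lemma dsym_cong:
  assumes "\<And>xs. xs \<in> permutations_of_set X \<Longrightarrow> f (coord xs) = g (coord xs)"
  shows "dsym X f = dsym X g"
  using assms by (simp add: dsym_def)

lemma length_permutation_of_set: "xs \<in> permutations_of_set X \<Longrightarrow> length xs = card X"
  by (metis distinct_card permutations_of_setD)

lemma diff_prod_Cons: "zs \<noteq> [] \<Longrightarrow> diff_prod (x # zs) = (x - hd zs) * diff_prod zs"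
  by (cases zs) auto

text \<open>Partial fractions: a \<open>0\<close> between neighbours \<open>x\<close> and
  \<open>y\<close> replaces the factor \<open>1 / (x - y)\<close> by \<open>- 1 / (x * y)\<close>,
  which is \<open>(1 / x - 1 / y) / (x - y)\<close>. At either end of the list one neighbour is
  missing and its reciprocal is read as \<open>0\<close>.\<close>

lemma inverse_diff_prod_insert_zero:
  fixes zs :: "'a::field list"
  assumes "distinct zs" "0 \<notin> set zs" "zs \<noteq> []" "k \<le> length zs"
  shows "1 / diff_prod (take k zs @ 0 # drop k zs) =
    ((if k = 0 then 0 else 1 / zs ! (k - 1)) - (if k = length zs then 0 else 1 / zs ! k)) / diff_prod zs"
  using assms
proof (induction zs arbitrary: k)
  case (Cons z zs)
  show ?case
  proof (cases zs)
    case Nil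
    then show ?thesis using Cons.prems by (cases k) auto
  next
    case zs: (Cons y ys)
    show ?thesis
    proof (cases k)
      case 0
      then show ?thesis by (simp add: divide_simps)
    next
      case (Suc k')
      show ?thesis
      proof (cases k')
        case 0
        have nz: "z \<noteq> 0" "y \<noteq> 0" "z - y \<noteq> 0" using Cons.prems zs by auto
        have "1 / ((z - 0) * ((0 - y) * d)) = (1 / z - 1 / y) / ((z - y) * d)" for d
        proof -
          have "1 / z - 1 / y = - ((z - y) / (z * y))" using nz by (simp add: diff_frac_eq minus_divide_left)
          then have "(1 / z - 1 / y) / ((z - y) * d) = - (((z - y) / (z - y)) * (1 / (z * y * d)))"
            by (simp add: mult.commute mult.left_commute)
          then show ?thesis using nz by (simp add: mult.assoc)
        qed
        then show ?thesis using Suc 0 zs by simp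
      next
        case (Suc k'')
        have IH: "1 / diff_prod (take k' zs @ 0 # drop k' zs) =
          ((if k' = 0 then 0 else 1 / zs ! (k' - 1)) - (if k' = length zs then 0 else 1 / zs ! k')) / diff_prod zs"
          using Cons.prems zs \<open>k = Suc k'\<close> by (intro Cons.IH) auto
        have "1 / diff_prod (take k (z # zs) @ 0 # drop k (z # zs)) =
          1 / diff_prod (take k' zs @ 0 # drop k' zs) / (z - y)"
          using zs Suc \<open>k = Suc k'\<close> by (simp add: diff_prod_Cons)
        then show ?thesis
          unfolding IH using zs Suc \<open>k = Suc k'\<close> by (simp add: mult.commute)
      qed
    qed
  qed
qed simp

lemma coord_insert_zero:
  assumes "k \<le> length zs" "j \<in> {1..Suc (length zs)}"
  shows "coord (take k zs @ 0 # drop k zs) j = ins_zero (Suc k) (coord zs) j"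
proof -
  have "j < Suc k \<or> j = Suc k \<or> (\<exists>m. j = Suc (Suc (k + m)))"
    by (metis less_iff_Suc_add linorder_neqE_nat add_Suc)
  then show ?thesis using assms by (auto simp: coord_def ins_zero_def nth_append)
qed

lemma bij_betw_insert_zero:
  assumes "finite X" "card X = n" "(0::'a::field) \<notin> X"
  shows "bij_betw (\<lambda>(k, zs). take k zs @ 0 # drop k zs)
    ({0..n} \<times> permutations_of_set X) (permutations_of_set (insert 0 X))"
proof (rule bij_betwI')
  fix p q assume "p \<in> {0..n} \<times> permutations_of_set X" "q \<in> {0..n} \<times> permutations_of_set X"
  then obtain k zs l ys where p: "p = (k, zs)" "q = (l, ys)" and
    zs: "zs \<in> permutations_of_set X" "ys \<in> permutations_of_set X" and kl: "k \<le> n" "l \<le> n"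
    by auto
  have *: "0 \<notin> set (take k zs)" "0 \<notin> set (take l ys)" "0 \<notin> set (drop k zs)" "0 \<notin> set (drop l ys)"
    "length zs = n" "length ys = n"
    using zs assms by (auto dest!: in_set_takeD in_set_dropD simp: permutations_of_set_def length_permutation_of_set)
  have "p = q" if "take k zs @ 0 # drop k zs = take l ys @ 0 # drop l ys"
  proof -
    have t: "take k zs = take l ys \<and> drop k zs = drop l ys"
      using that * by (metis append_Cons_eq_iff)
    then have "zs = ys" by (metis append_take_drop_id)
    moreover have "k = l" using t * kl by (metis length_take min_absorb2)
    ultimately show ?thesis using p by simp
  qed
  then show "((case p of (k, zs) \<Rightarrow> take k zs @ 0 # drop k zs) = (case q of (k, zs) \<Rightarrow> take k zs @ 0 # drop k zs)) = (p = q)"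
    using p by auto
next
  fix p assume "p \<in> {0..n} \<times> permutations_of_set X"
  then obtain k zs where p: "p = (k, zs)" "k \<le> n" "set zs = X" "distinct zs"
    by (auto simp: permutations_of_set_def)
  have "set (take k zs) \<union> set (drop k zs) = X" using p by (metis append_take_drop_id set_append)
  moreover have "distinct (take k zs @ drop k zs)" using p by simp
  ultimately show "(case p of (k, zs) \<Rightarrow> take k zs @ 0 # drop k zs) \<in> permutations_of_set (insert 0 X)"
    using assms p unfolding distinct_append by (auto intro!: permutations_of_setI)
next
  fix ys assume ys: "ys \<in> permutations_of_set (insert 0 X)"
  then obtain as bs where ab: "ys = as @ 0 # bs"
    by (metis insertI1 permutations_of_setD(1) split_list)
  have "as @ bs \<in> permutations_of_set X"
    using ys ab assms insert_ident[of 0 "set (as @ bs)" X] by (simp add: permutations_of_set_def)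
  moreover have "length as \<le> n"
    using calculation assms by (metis distinct_card le_add1 length_append permutations_of_setD)
  ultimately show "\<exists>p\<in>{0..n} \<times> permutations_of_set X. ys = (case p of (k, zs) \<Rightarrow> take k zs @ 0 # drop k zs)"
    using ab by (intro bexI[of _ "(length as, as @ bs)"]) auto
qed

text \<open>The term of the permutation with \<open>0\<close> between the entries \<open>z\<^sub>k\<close> and \<open>z\<^sub>k\<^sub>+\<^sub>1\<close>
  carries the factor \<open>1/z\<^sub>k - 1/z\<^sub>k\<^sub>+\<^sub>1\<close>; summation by parts turns these factors into the
  difference quotients \<open>trim\<close>.\<close>

lemma dsym_insert_zero:
  assumes X: "finite X" "card X = n" "n \<ge> 1" "0 \<notin> X"
    and g: "\<And>y z. (\<And>j. j \<in> {1..Suc n} \<Longrightarrow> y j = z j) \<Longrightarrow> g y = g z"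
  shows "dsym (insert 0 X) g = (\<Sum>i=1..n. dsym X (trim i g))"
proof -
  \<comment> \<open>With \<open>k\<close> entries in front of the \<open>0\<close>, that entry has
    coordinate \<open>k + 1\<close>; hence \<open>Suc k\<close>.\<close>
  define h where "h z k = g (ins_zero (Suc k) z)" for z k
  have "(\<Sum>k=0..n. g (coord (take k zs @ 0 # drop k zs)) / diff_prod (take k zs @ 0 # drop k zs))
      = (\<Sum>i=1..n. trim i g (coord zs) / diff_prod zs)"
    if "zs \<in> permutations_of_set X" for zs
  proof -
    have zs: "distinct zs" "set zs = X" "length zs = n"
      using that X by (auto dest: permutations_of_setD simp: length_permutation_of_set)
    let ?z = "coord zs"
    have "(\<Sum>k=0..n. g (coord (take k zs @ 0 # drop k zs)) / diff_prod (take k zs @ 0 # drop k zs))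
      = (\<Sum>k=0..n. h ?z k * ((if k = 0 then 0 else 1 / ?z k) - (if k = n then 0 else 1 / ?z (Suc k))) / diff_prod zs)"
    proof (rule sum.cong[OF refl])
      fix k assume k: "k \<in> {0..n}"
      have "g (coord (take k zs @ 0 # drop k zs)) = h ?z k"
        unfolding h_def using k zs by (intro g coord_insert_zero) auto
      moreover have "1 / diff_prod (take k zs @ 0 # drop k zs) =
        ((if k = 0 then 0 else 1 / zs ! (k - 1)) - (if k = length zs then 0 else 1 / zs ! k)) / diff_prod zs"
        using zs X k by (intro inverse_diff_prod_insert_zero) auto
      ultimately show "g (coord (take k zs @ 0 # drop k zs)) / diff_prod (take k zs @ 0 # drop k zs) =
        h ?z k * ((if k = 0 then 0 else 1 / ?z k) - (if k = n then 0 else 1 / ?z (Suc k))) / diff_prod zs"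
        using zs unfolding coord_def
        by (metis (no_types, lifting) diff_Suc_1 divide_inverse inverse_eq_divide mult.assoc)
    qed
    also have "\<dots> = (\<Sum>k=0..n. h ?z k * ((if k = 0 then 0 else 1 / ?z k) - (if k = n then 0 else 1 / ?z (Suc k)))) / diff_prod zs"
      by (simp add: sum_divide_distrib)
    also have "(\<Sum>k=0..n. h ?z k * ((if k = 0 then 0 else 1 / ?z k) - (if k = n then 0 else 1 / ?z (Suc k))))
      = (\<Sum>k=0..n. h ?z k * (if k = 0 then 0 else 1 / ?z k)) - (\<Sum>k=0..n. h ?z k * (if k = n then 0 else 1 / ?z (Suc k)))"
      by (simp add: right_diff_distrib sum_subtractf)
    also have "(\<Sum>k=0..n. h ?z k * (if k = 0 then 0 else 1 / ?z k)) = (\<Sum>i=1..n. h ?z i / ?z i)"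
      by (rule sum.mono_neutral_cong_right) auto
    also have "(\<Sum>k=0..n. h ?z k * (if k = n then 0 else 1 / ?z (Suc k))) = (\<Sum>k=0..<n. h ?z k / ?z (Suc k))"
      by (rule sum.mono_neutral_cong_right) auto
    also have "\<dots> = (\<Sum>i=1..n. h ?z (i - 1) / ?z i)"
      by (rule sum.reindex_bij_witness[of _ "\<lambda>i. i - 1" Suc]) auto
    also have "(\<Sum>i=1..n. h ?z i / ?z i) - \<dots> = (\<Sum>i=1..n. trim i g ?z)"
      unfolding sum_subtractf[symmetric] by (rule sum.cong) (auto simp: trim_def h_def diff_divide_distrib)
    finally show ?thesis by (simp add: sum_divide_distrib)
  qed
  then have "(\<Sum>zs\<in>permutations_of_set X. \<Sum>k=0..n. g (coord (take k zs @ 0 # drop k zs)) / diff_prod (take k zs @ 0 # drop k zs))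
    = (\<Sum>zs\<in>permutations_of_set X. \<Sum>i=1..n. trim i g (coord zs) / diff_prod zs)" by simp
  then have "(\<Sum>k=0..n. \<Sum>zs\<in>permutations_of_set X. g (coord (take k zs @ 0 # drop k zs)) / diff_prod (take k zs @ 0 # drop k zs))
    = (\<Sum>i=1..n. dsym X (trim i g))"
    unfolding dsym_def by (subst (1 2) sum.swap)
  moreover have "dsym (insert 0 X) g = (\<Sum>p\<in>{0..n} \<times> permutations_of_set X.
      g (coord (case p of (k, zs) \<Rightarrow> take k zs @ 0 # drop k zs)) / diff_prod (case p of (k, zs) \<Rightarrow> take k zs @ 0 # drop k zs))"
    unfolding dsym_def by (rule sum.reindex_bij_betw[OF bij_betw_insert_zero[OF X(1,2,4)], symmetric])
  ultimately show ?thesis by (simp add: sum.cartesian_product case_prod_unfold)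
qed

section \<open>Constancy of the symmetrization in top degree, vanishing below it\<close>

lemma monom_at_ins_zero:
  "monom_at a (ins_zero i z) = (if i \<in> set a then 0 else monom_at (map (\<lambda>j. if j < i then j else j - 1) a) z)"
  by (induction a) (auto simp: monom_at_def ins_zero_def)

lemma monom_at_remove1: "i \<in> set a \<Longrightarrow> monom_at a z = z i * monom_at (remove1 i a) z"
  unfolding monom_at_def by (induction a) (auto simp: algebra_simps)

text \<open>A \<open>0\<close> at place \<open>i\<close> kills the monomials containing the index
  \<open>i\<close> and moves the index \<open>i + 1\<close> to \<open>i\<close>. If both or neither
  of \<open>i\<close> and \<open>i + 1\<close> occur, the two substitutions agree and cancel; if
  exactly one occurs, a single monomial containing the index \<open>i\<close> survives, and division
  by \<open>z i\<close> lowers its degree by one. The sign \<open>s\<close> records which case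
  occurs, with \<open>a' = []\<close> as a dummy when \<open>s = 0\<close>.\<close>

lemma trim_monom_at:
  assumes a: "set a \<subseteq> {1..Suc n}" and i: "i \<in> {1..n}"
  shows "\<exists>s a'. set a' \<subseteq> {1..n} \<and> (s = 0 \<and> a' = [] \<or> Suc (length a') = length a) \<and>
    (\<forall>z::nat \<Rightarrow> 'a::field. z i \<noteq> 0 \<longrightarrow> trim i (monom_at a) z = s * monom_at a' z)"
proof -
  define p where "p = map (\<lambda>j. if j < i then j else j - 1) a"
  define q where "q = map (\<lambda>j. if j < Suc i then j else j - 1) a"
  have len: "Suc (length (remove1 i b)) = length b" if "i \<in> set b" for b
    using that by (simp add: length_remove1) (metis Suc_pred length_pos_if_in_set)
  have sub: "set (remove1 i p) \<subseteq> {1..n}" if "i \<notin> set a"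
  proof -
    have "(if j < i then j else j - 1) \<in> {1..n}" if "j \<in> set a" for j
      using subsetD[OF a that] i that \<open>i \<notin> set a\<close> by (cases "j = i") (auto split: if_splits)
    then have "set p \<subseteq> {1..n}" unfolding p_def set_map by blast
    then show ?thesis using set_remove1_subset by fastforce
  qed
  have sub': "set (remove1 i q) \<subseteq> {1..n}" if "Suc i \<notin> set a"
  proof -
    have "(if j < Suc i then j else j - 1) \<in> {1..n}" if "j \<in> set a" for j
      using subsetD[OF a that] i that \<open>Suc i \<notin> set a\<close> by (cases "j = Suc i") (auto split: if_splits)
    then have "set q \<subseteq> {1..n}" unfolding q_def set_map by blast
    then show ?thesis using set_remove1_subset by fastforce
  qed
  consider "i \<in> set a" "Suc i \<in> set a" | "i \<notin> set a" "Suc i \<notin> set a"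
    | "i \<in> set a" "Suc i \<notin> set a" | "i \<notin> set a" "Suc i \<in> set a" by blast
  then show ?thesis
  proof cases
    case 1
    then show ?thesis by (intro exI[of _ 0] exI[of _ "[]"]) (auto simp: trim_def monom_at_ins_zero)
  next
    case 2
    then have "p = q" unfolding p_def q_def by (auto simp: less_Suc_eq)
    then show ?thesis using 2
      by (intro exI[of _ 0] exI[of _ "[]"]) (auto simp: trim_def monom_at_ins_zero p_def[symmetric] q_def[symmetric])
  next
    case 3
    have "i \<in> set q" using 3 unfolding q_def by force
    then have "trim i (monom_at a) z = 1 * monom_at (remove1 i q) z" if "z i \<noteq> 0" for z :: "nat \<Rightarrow> 'a"
      using that 3 unfolding trim_def monom_at_ins_zero q_def[symmetric] by (simp add: monom_at_remove1)
    moreover have "Suc (length (remove1 i q)) = length a"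
      using len[OF \<open>i \<in> set q\<close>] by (simp add: q_def)
    ultimately show ?thesis using sub'[OF 3(2)] by blast
  next
    case 4
    have "i \<in> set p" using 4 unfolding p_def by force
    then have "trim i (monom_at a) z = (-1) * monom_at (remove1 i p) z" if "z i \<noteq> 0" for z :: "nat \<Rightarrow> 'a"
      using that 4 unfolding trim_def monom_at_ins_zero p_def[symmetric] by (simp add: monom_at_remove1)
    moreover have "Suc (length (remove1 i p)) = length a"
      using len[OF \<open>i \<in> set p\<close>] by (simp add: p_def)
    ultimately show ?thesis using sub[OF 4(1)] by blast
  qed
qed

lemma coord_ne_zero:
  assumes "xs \<in> permutations_of_set X" "0 \<notin> X" "finite X" "i \<in> {1..card X}"
  shows "coord xs i \<noteq> 0"
proof -
  have "length xs = card X" "set xs = X"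
    using assms by (auto dest: permutations_of_setD simp: length_permutation_of_set)
  then have "coord xs i \<in> X" unfolding coord_def using assms by (metis One_nat_def Suc_le_D atLeastAtMost_iff diff_Suc_1 less_eq_Suc_le nth_mem)
  then show ?thesis using assms by auto
qed

lemma monom_at_cong: "(\<And>j. j \<in> set a \<Longrightarrow> y j = z j) \<Longrightarrow> monom_at a y = monom_at a z"
  unfolding monom_at_def by (metis map_cong)

text \<open>The denominators only contain differences, so they do not see a translation.\<close>

lemma dsym_translate:
  fixes X :: "'a::field set"
  assumes "\<And>xs. xs \<in> permutations_of_set X \<Longrightarrow>
    f (coord xs) = g (coord (map (\<lambda>x. x - t) xs))"
  shows "dsym X f = dsym ((\<lambda>x. x - t) ` X) g"
proof -
  have inj: "inj_on (\<lambda>x. x - t) X" by (simp add: inj_on_def)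
  have dp: "diff_prod (map (\<lambda>x. x - t) xs) = diff_prod xs" for xs
    by (induction xs rule: diff_prod.induct) auto
  have "dsym ((\<lambda>x. x - t) ` X) g = (\<Sum>xs\<in>map (\<lambda>x. x - t) ` permutations_of_set X. g (coord xs) / diff_prod xs)"
    using inj by (simp add: dsym_def permutations_of_set_image_inj)
  also have "\<dots> = (\<Sum>xs\<in>permutations_of_set X. g (coord (map (\<lambda>x. x - t) xs)) / diff_prod xs)"
  proof (subst sum.reindex)
    show "inj_on (map (\<lambda>x. x - t)) (permutations_of_set X)"
      by (rule inj_on_subset[OF inj_mapI]) (auto intro: injI)
  qed (simp add: dp)
  also have "\<dots> = dsym X f" using assms by (simp add: dsym_def)
  finally show ?thesis ..
qed

text \<open>Translating \<open>X\<close> so that it contains \<open>0\<close> changes a monomial only by terms of lower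
  degree, on which \<open>dsym\<close> vanishes.\<close>

lemma dsym_monom_at_const:
  assumes "set a \<subseteq> {1..Suc n}" "length a \<le> n"
  shows "\<exists>c::'a::field. (length a < n \<longrightarrow> c = 0) \<and>
    (\<forall>X. finite X \<longrightarrow> card X = Suc n \<longrightarrow> dsym X (monom_at a) = c)"
  using assms
proof (induction n arbitrary: a)
  case 0
  have "dsym X (monom_at a) = 1" if card: "card X = Suc 0" for X :: "'a set"
  proof -
    obtain x where "X = {x}" using card by (auto simp: card_1_singleton_iff)
    then show ?thesis using 0 by (simp add: dsym_def monom_at_def)
  qed
  then show ?case by auto
next
  case (Suc n)
  \<comment> \<open>For sets containing \<open>0\<close>, the operator \<open>trim\<close> lowers
    the number of points and the degree by one each, so the induction hypothesis applies to every
    summand.\<close>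
  have zero: "\<exists>c::'a. (length a < Suc n \<longrightarrow> c = 0) \<and>
    (\<forall>X. finite X \<longrightarrow> card X = Suc (Suc n) \<longrightarrow> 0 \<in> X \<longrightarrow> dsym X (monom_at a) = c)"
    if a: "set a \<subseteq> {1..Suc (Suc n)}" "length a \<le> Suc n" for a
  proof -
    have "\<exists>c::'a. (length a < Suc n \<longrightarrow> c = 0) \<and>
      (\<forall>X. finite X \<longrightarrow> card X = Suc n \<longrightarrow> 0 \<notin> X \<longrightarrow> dsym X (trim i (monom_at a)) = c)"
      if i: "i \<in> {1..Suc n}" for i
    proof -
      obtain s :: 'a and a' where a': "set a' \<subseteq> {1..Suc n}" "s = 0 \<and> a' = [] \<or> Suc (length a') = length a"
        "\<forall>z. z i \<noteq> 0 \<longrightarrow> trim i (monom_at a) z = s * monom_at a' z"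
        using trim_monom_at[OF a(1) i] by blast
      then have "length a' \<le> n" using a(2) by auto
      then obtain c :: 'a where c: "length a' < n \<longrightarrow> c = 0" "\<And>X. finite X \<Longrightarrow> card X = Suc n \<Longrightarrow> dsym X (monom_at a') = c"
        using Suc.IH[of a'] a'(1) by blast
      have "dsym X (trim i (monom_at a)) = s * c" if "finite X" "card X = Suc n" "0 \<notin> X" for X
      proof -
        have "dsym X (trim i (monom_at a)) = dsym X (\<lambda>z. s * monom_at a' z)"
          using a'(3) coord_ne_zero[of _ X i] i that by (intro dsym_cong) auto
        then show ?thesis using c that by (simp add: dsym_cmult)
      qed
      then show ?thesis using c a' by (intro exI[of _ "s * c"]) auto
    qed
    then obtain c :: "nat \<Rightarrow> 'a" where c: "\<And>i. i \<in> {1..Suc n} \<Longrightarrow> length a < Suc n \<longrightarrow> c i = 0"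
      "\<And>i X. i \<in> {1..Suc n} \<Longrightarrow> finite X \<Longrightarrow> card X = Suc n \<Longrightarrow> 0 \<notin> X \<Longrightarrow> dsym X (trim i (monom_at a)) = c i"
      by metis
    have "dsym X (monom_at a) = (\<Sum>i=1..Suc n. c i)" if X: "finite X" "card X = Suc (Suc n)" "0 \<in> X" for X
    proof -
      have "dsym (insert 0 (X - {0})) (monom_at a) = (\<Sum>i=1..Suc n. dsym (X - {0}) (trim i (monom_at a)))"
        by (rule dsym_insert_zero) (use X a in \<open>auto intro!: monom_at_cong\<close>)
      also have "\<dots> = (\<Sum>i=1..Suc n. c i)"
        by (intro sum.cong refl c(2)) (use X in auto)
      finally show ?thesis using X by (simp add: insert_absorb)
    qed
    then show ?thesis using c(1) by (intro exI[of _ "\<Sum>i=1..Suc n. c i"]) auto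
  qed
  \<comment> \<open>The factors \<open>z j + t\<close> are multiplied out one at a time,
    \<open>b\<close> collecting those already treated. Each constant \<open>t\<close> leaves a
    monomial of too small degree, which contributes \<open>0\<close> by \<open>zero\<close>.\<close>
  have shift: "dsym X (\<lambda>z. monom_at b z * monom_at a (\<lambda>j. z j + t)) = dsym X (monom_at (b @ a))"
    if "finite X" "card X = Suc (Suc n)" "0 \<in> X" "set (b @ a) \<subseteq> {1..Suc (Suc n)}" "length (b @ a) \<le> Suc n"
    for X :: "'a set" and a b t
    using that(4,5)
  proof (induction a arbitrary: b)
    case Nil
    then show ?case by (simp add: monom_at_def)
  next
    case (Cons j a)
    have "dsym X (\<lambda>z. monom_at b z * monom_at (j # a) (\<lambda>j. z j + t)) =
      dsym X (\<lambda>z. monom_at (b @ [j]) z * monom_at a (\<lambda>j. z j + t) + t * (monom_at b z * monom_at a (\<lambda>j. z j + t)))"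
      by (simp add: monom_at_def algebra_simps)
    also have "\<dots> = dsym X (monom_at ((b @ [j]) @ a)) + t * dsym X (monom_at (b @ a))"
      unfolding dsym_add dsym_cmult using Cons.IH[of "b @ [j]"] Cons.IH[of b] Cons.prems by simp
    also have "dsym X (monom_at (b @ a)) = 0"
      using zero[of "b @ a"] Cons.prems that by fastforce
    finally show ?case by simp
  qed
  obtain c :: 'a where c: "length a < Suc n \<longrightarrow> c = 0"
    "\<And>X. finite X \<Longrightarrow> card X = Suc (Suc n) \<Longrightarrow> 0 \<in> X \<Longrightarrow> dsym X (monom_at a) = c"
    using zero[of a] Suc.prems by blast
  have "dsym X (monom_at a) = c" if X: "finite X" "card X = Suc (Suc n)" for X
  proof -
    obtain t where t: "t \<in> X" using X by fastforce
    let ?Y = "(\<lambda>x. x - t) ` X"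
    have Y: "finite ?Y" "card ?Y = Suc (Suc n)" "0 \<in> ?Y"
      using X t by (auto simp: card_image inj_on_def image_iff)
    have "dsym X (monom_at a) = dsym ?Y (\<lambda>z. monom_at a (\<lambda>j. z j + t))"
    proof (rule dsym_translate)
      fix xs assume "xs \<in> permutations_of_set X"
      then have "length xs = Suc (Suc n)" using X by (metis distinct_card permutations_of_setD)
      then show "monom_at a (coord xs) = monom_at a (\<lambda>j. coord (map (\<lambda>x. x - t) xs) j + t)"
        using Suc.prems by (intro monom_at_cong) (force simp: coord_def)
    qed
    also have "\<dots> = c"
      using shift[OF Y, of "[]" a t] Suc.prems c(2)[OF Y] by (simp add: monom_at_def[of "[]"])
    finally show ?thesis .
  qed
  then show ?case using c(1) by auto
qed

subsection \<open>Forest polynomials\<close>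

text \<open>The nodes \<open>V\<close> of an indexed forest are recorded by their canonical label \<open>c u\<close> and the
  interval \<open>INT(u) = {lo u..hi u}\<close>; then \<open>v\<close> is a descendant of \<open>u\<close> iff
  \<open>c v \<in> {lo u..hi u}\<close>, on the left or on the right according to the order of \<open>c v\<close> and \<open>c u\<close>.\<close>

locale indexed_forest =
  fixes V :: "'v set" and c lo hi :: "'v \<Rightarrow> int"
  assumes finite_V: "finite V"
    and lo_le: "u \<in> V \<Longrightarrow> lo u \<le> c u" and le_hi: "u \<in> V \<Longrightarrow> c u \<le> hi u"
    and inj_c: "inj_on c V"
    and full: "u \<in> V \<Longrightarrow> {lo u..hi u} \<subseteq> c ` V"
    and nested: "u \<in> V \<Longrightarrow> v \<in> V \<Longrightarrow> u \<noteq> v \<Longrightarrow> c v \<in> {lo u..hi u} \<Longrightarrow>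
      lo u \<le> lo v \<and> hi v \<le> hi u \<and> c u \<notin> {lo v..hi v}"

text \<open>The bound \<open>b\<close> is a separate parameter because inserting a \<open>0\<close>
  among the variables changes the bounds but not the shape.\<close>

definition fillings :: "'v set \<Rightarrow> ('v \<Rightarrow> int) \<Rightarrow> ('v \<Rightarrow> int) \<Rightarrow> ('v \<Rightarrow> int) \<Rightarrow> ('v \<Rightarrow> int) \<Rightarrow> ('v \<Rightarrow> nat) set" where
  "fillings V c lo hi b = {f \<in> extensional V. (\<forall>u\<in>V. 1 \<le> f u \<and> int (f u) \<le> b u) \<and>
     (\<forall>u\<in>V. \<forall>v\<in>V. (lo u \<le> c v \<longrightarrow> c v < c u \<longrightarrow> f u \<le> f v) \<and> (c u < c v \<longrightarrow> c v \<le> hi u \<longrightarrow> f u < f v))}"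

definition forest_poly :: "'v set \<Rightarrow> ('v \<Rightarrow> int) \<Rightarrow> ('v \<Rightarrow> int) \<Rightarrow> ('v \<Rightarrow> int) \<Rightarrow> ('v \<Rightarrow> int) \<Rightarrow> (nat \<Rightarrow> 'a::field) \<Rightarrow> 'a" where
  "forest_poly V c lo hi b x = (\<Sum>f\<in>fillings V c lo hi b. \<Prod>u\<in>V. x (f u))"

text \<open>No entry is followed by one of its descendants, so leaves come early and roots late, in
  the direction in which insertion builds the forest.\<close>

definition lin_exts :: "'v set \<Rightarrow> ('v \<Rightarrow> int) \<Rightarrow> ('v \<Rightarrow> int) \<Rightarrow> ('v \<Rightarrow> int) \<Rightarrow> 'v list set" where
  "lin_exts V c lo hi = {W. distinct W \<and> set W = V \<and> sorted_wrt (\<lambda>u v. c v \<notin> {lo u..hi u}) W}"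

lemma finite_fillings:
  assumes "finite V" shows "finite (fillings V c lo hi b)"
proof (rule finite_subset)
  show "fillings V c lo hi b \<subseteq> PiE V (\<lambda>u. {..nat (b u)})"
    unfolding fillings_def PiE_def Pi_def using nat_le_iff by fastforce
  show "finite (PiE V (\<lambda>u. {..nat (b u)}))" using assms by (intro finite_PiE) auto
qed

lemma finite_lin_exts: "finite V \<Longrightarrow> finite (lin_exts V c lo hi)"
  by (rule finite_subset[OF _ finite_permutations_of_set[of V]]) (auto simp: lin_exts_def)

section \<open>Fillings under insertion of a zero and removal of a leaf\<close>

definition skip :: "nat \<Rightarrow> nat \<Rightarrow> nat" where
  "skip i j = (if j < i then j else Suc j)"

definition squeeze :: "nat \<Rightarrow> int \<Rightarrow> int" where
  "squeeze i s = (if s < int i then s else s - 1)"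

lemma skip_less_iff: "skip i j < skip i k \<longleftrightarrow> j < k"
  by (auto simp: skip_def)

lemma skip_le_iff: "skip i j \<le> skip i k \<longleftrightarrow> j \<le> k"
  by (auto simp: skip_def)

text \<open>\<open>squeeze i\<close> is the upper adjoint of \<open>skip i\<close>: bounds on a
  filling that avoids the value \<open>i\<close> become bounds on the filling with this gap
  closed.\<close>

lemma skip_le_squeeze: "int (skip i j) \<le> s \<longleftrightarrow> int j \<le> squeeze i s"
  by (auto simp: skip_def squeeze_def)

lemma one_le_skip: "i \<ge> 1 \<Longrightarrow> 1 \<le> skip i j \<longleftrightarrow> 1 \<le> j"
  by (auto simp: skip_def)

lemma ins_zero_skip: "ins_zero i x (skip i j) = x j"
  by (auto simp: ins_zero_def skip_def)

lemma skip_surj: "k \<noteq> i \<Longrightarrow> skip i (if k < i then k else k - 1) = k"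
  by (auto simp: skip_def)

text \<open>A filling that uses the value \<open>i\<close> has the factor \<open>0\<close>. The
  others are \<open>skip i\<close> applied to a filling, and since \<open>skip i\<close> is strictly
  increasing, all order conditions are kept and only the bounds move.\<close>

lemma forest_poly_ins_zero:
  assumes "finite V" "i \<ge> 1"
  shows "forest_poly V c lo hi b (ins_zero i x) = forest_poly V c lo hi (\<lambda>u. squeeze i (b u)) x"
proof -
  let ?S = "{f \<in> fillings V c lo hi b. \<forall>u\<in>V. f u \<noteq> i}"
  let ?up = "\<lambda>f. restrict (\<lambda>u. skip i (f u)) V"
  let ?dn = "\<lambda>f. restrict (\<lambda>u. if f u < i then f u else f u - 1) V"
  have "forest_poly V c lo hi b (ins_zero i x) = (\<Sum>f\<in>?S. \<Prod>u\<in>V. ins_zero i x (f u))"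
    unfolding forest_poly_def
  proof (rule sum.mono_neutral_right)
    show "\<forall>f\<in>fillings V c lo hi b - ?S. (\<Prod>u\<in>V. ins_zero i x (f u)) = 0"
      using assms by (auto intro!: prod_zero simp: ins_zero_def)
  qed (auto simp: finite_fillings assms)
  also have "\<dots> = (\<Sum>f\<in>fillings V c lo hi (\<lambda>u. squeeze i (b u)). \<Prod>u\<in>V. x (f u))"
  proof (rule sum.reindex_bij_witness[of _ ?up ?dn])
    fix f assume f: "f \<in> ?S"
    define g where "g = ?dn f"
    have fg: "f u = skip i (g u)" if "u \<in> V" for u
      using f that by (auto simp: g_def skip_surj)
    show up: "?up (?dn f) = f"
      using f fg unfolding g_def[symmetric] by (auto simp: fillings_def fun_eq_iff extensional_def)
    have "g \<in> extensional V" by (simp add: g_def)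
    then show "?dn f \<in> fillings V c lo hi (\<lambda>u. squeeze i (b u))"
      using f unfolding g_def[symmetric] fillings_def
      by (simp add: fg skip_less_iff skip_le_iff skip_le_squeeze one_le_skip[OF assms(2)] One_nat_def[symmetric] del: One_nat_def cong: ball_cong)
    show "(\<Prod>u\<in>V. x (?dn f u)) = (\<Prod>u\<in>V. ins_zero i x (f u))"
      unfolding g_def[symmetric] by (rule prod.cong) (auto simp: fg ins_zero_skip)
  next
    fix f assume f: "f \<in> fillings V c lo hi (\<lambda>u. squeeze i (b u))"
    then have ext: "f \<in> extensional V" by (simp add: fillings_def)
    show "?dn (?up f) = f"
      using ext by (auto simp: fun_eq_iff extensional_def skip_def)
    show "?up f \<in> ?S"
      using f unfolding fillings_def
      by (auto simp: skip_less_iff skip_le_iff skip_le_squeeze one_le_skip[OF assms(2)] One_nat_def[symmetric] simp del: One_nat_def)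
        (auto simp: skip_def split: if_splits)
  qed
  finally show ?thesis by (simp add: forest_poly_def)
qed

context indexed_forest
begin

lemma eq_if_c_eq: "u \<in> V \<Longrightarrow> v \<in> V \<Longrightarrow> c u = c v \<Longrightarrow> u = v"
  using inj_c by (auto dest: inj_onD)

text \<open>Labels above \<open>i\<close> move down by one. An interval starting at \<open>i\<close>
  still starts at \<open>i\<close>, now the former label \<open>i + 1\<close>, but one ending at
  \<open>i\<close> loses its last element; hence the different thresholds \<open>Suc i\<close> and
  \<open>i\<close>.\<close>

abbreviation c' where "c' i u \<equiv> squeeze (Suc i) (c u)"
abbreviation lo' where "lo' i u \<equiv> squeeze (Suc i) (lo u)"
abbreviation hi' where "hi' i u \<equiv> squeeze i (hi u)"

lemma squeeze_iffs:
  assumes "u0 \<in> V" "c u0 = int i" "u \<in> V - {u0}" "v \<in> V - {u0}"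
  shows "lo' i u \<le> c' i v \<longleftrightarrow> lo u \<le> c v"
    and "c' i v \<le> hi' i u \<longleftrightarrow> c v \<le> hi u"
    and "c' i v < c' i u \<longleftrightarrow> c v < c u"
proof -
  have "c u \<noteq> int i" "c v \<noteq> int i"
    using assms inj_c by (metis DiffD1 DiffD2 inj_onD singletonI)+
  then show "lo' i u \<le> c' i v \<longleftrightarrow> lo u \<le> c v" "c' i v \<le> hi' i u \<longleftrightarrow> c v \<le> hi u"
    "c' i v < c' i u \<longleftrightarrow> c v < c u"
    by (auto simp: squeeze_def)
qed

lemma indexed_forest_trim:
  assumes u0: "u0 \<in> V" "lo u0 = int i" "hi u0 = int i"
  shows "indexed_forest (V - {u0}) (c' i) (lo' i) (hi' i)"
proof
  have c0: "c u0 = int i" using lo_le[OF u0(1)] le_hi[OF u0(1)] u0 by simp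
  note iffs = squeeze_iffs[OF u0(1) c0]
  show "finite (V - {u0})" using finite_V by simp
  show "lo' i u \<le> c' i u" "c' i u \<le> hi' i u" if "u \<in> V - {u0}" for u
    using that iffs[of u u] lo_le le_hi by auto
  show "inj_on (c' i) (V - {u0})"
  proof (rule inj_onI)
    fix u v assume uv: "u \<in> V - {u0}" "v \<in> V - {u0}" "c' i u = c' i v"
    then have "c u = c v" using iffs(3)[of u v] iffs(3)[of v u] by auto
    then show "u = v" using uv inj_c by (auto dest: inj_onD)
  qed
  show "{lo' i u..hi' i u} \<subseteq> c' i ` (V - {u0})" if u: "u \<in> V - {u0}" for u
  proof
    fix j assume j: "j \<in> {lo' i u..hi' i u}"
    \<comment> \<open>\<open>k\<close> is the preimage of \<open>j\<close> under
      \<open>squeeze (Suc i)\<close> that avoids the deleted label \<open>i\<close>.\<close>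
    define k where "k = (if j < int i then j else j + 1)"
    have "c u \<noteq> int i" using u c0 u0 eq_if_c_eq[of u u0] by auto
    then have "k \<in> {lo u..hi u}" "k \<noteq> int i" "squeeze (Suc i) k = j"
      using j by (auto simp: k_def squeeze_def split: if_splits)
    moreover obtain v where "v \<in> V" "c v = k" using full[of u] u calculation by fastforce
    ultimately show "j \<in> c' i ` (V - {u0})" using c0 by (intro image_eqI[of _ _ v]) auto
  qed
  fix u v assume uv: "u \<in> V - {u0}" "v \<in> V - {u0}" "u \<noteq> v" "c' i v \<in> {lo' i u..hi' i u}"
  then have "lo u \<le> lo v \<and> hi v \<le> hi u \<and> c u \<notin> {lo v..hi v}"
    using nested[of u v] iffs[of u v] by auto
  then show "lo' i u \<le> lo' i v \<and> hi' i v \<le> hi' i u \<and> c' i u \<notin> {lo' i v..hi' i v}"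
    using iffs[of v u] uv by (auto simp: squeeze_def)
qed

lemma fillings_trim:
  assumes "u0 \<in> V" "c u0 = int i"
  shows "fillings (V - {u0}) (c' i) (lo' i) (hi' i) b = fillings (V - {u0}) c lo hi b"
  unfolding fillings_def
  by (intro Collect_cong conj_cong ball_cong refl) (simp_all only: squeeze_iffs[OF assms])

lemma lin_exts_trim:
  assumes "u0 \<in> V" "c u0 = int i"
  shows "lin_exts (V - {u0}) (c' i) (lo' i) (hi' i) = lin_exts (V - {u0}) c lo hi"
proof -
  have "sorted_wrt (\<lambda>u v. c' i v \<notin> {lo' i u..hi' i u}) W = sorted_wrt (\<lambda>u v. c v \<notin> {lo u..hi u}) W"
    if "set W = V - {u0}" for W
    using squeeze_iffs[OF assms] that
    by (intro iffI; elim sorted_wrt_mono_rel[rotated]; simp)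
  then show ?thesis unfolding lin_exts_def by blast
qed

text \<open>The two bounds differ only at nodes with \<open>lo u = i\<close>. A filling separating them attains the
  value \<open>i\<close> at the node with label \<open>i\<close>, and this node has no right child, since that child would
  need a value in \<open>{i<..i}\<close>.\<close>

lemma fillings_squeeze_Suc:
  assumes i: "i \<ge> 1"
  shows "fillings V c lo hi (\<lambda>u. squeeze (Suc i) (lo u)) - fillings V c lo hi (\<lambda>u. squeeze i (lo u))
    = {f \<in> fillings V c lo hi (\<lambda>u. squeeze (Suc i) (lo u)). \<exists>u\<in>V. lo u = int i \<and> hi u = int i \<and> f u = i}"
    (is "?A - ?B = ?C")
proof
  show "?A - ?B \<subseteq> ?C"
  proof
    fix f assume f: "f \<in> ?A - ?B"
    then have fA: "f \<in> ?A" by simp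
    then have ord: "\<And>u v. u \<in> V \<Longrightarrow> v \<in> V \<Longrightarrow> lo u \<le> c v \<Longrightarrow> c v < c u \<Longrightarrow> f u \<le> f v"
      "\<And>u v. u \<in> V \<Longrightarrow> v \<in> V \<Longrightarrow> c u < c v \<Longrightarrow> c v \<le> hi u \<Longrightarrow> f u < f v"
      and bd: "\<And>u. u \<in> V \<Longrightarrow> int (f u) \<le> squeeze (Suc i) (lo u)"
      by (auto simp: fillings_def)
    obtain u where u: "u \<in> V" "\<not> int (f u) \<le> squeeze i (lo u)"
      using f by (fastforce simp: fillings_def)
    with bd[OF u(1)] have lu: "lo u = int i" "f u = i" by (auto simp: squeeze_def split: if_splits)
    obtain u0 where u0: "u0 \<in> V" "c u0 = int i"
      using full[OF u(1)] lo_le[OF u(1)] le_hi[OF u(1)] lu by force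
    have l0: "lo u0 = int i"
      using nested[OF u(1) u0(1)] lo_le[OF u0(1)] lo_le[OF u(1)] le_hi[OF u(1)] u0 lu by (cases "u = u0") auto
    have "f u \<le> f u0"
      using ord(1)[OF u(1) u0(1)] u0 lu lo_le[OF u(1)] inj_onD[OF inj_c, of u u0] u(1)
      by (cases "u = u0") fastforce+
    moreover have "f u0 \<le> i" using bd[OF u0(1)] l0 by (simp add: squeeze_def)
    ultimately have f0: "f u0 = i" using lu by simp
    have "hi u0 = int i"
    proof (rule ccontr)
      assume "hi u0 \<noteq> int i"
      then have h: "int i + 1 \<in> {lo u0..hi u0}" using le_hi[OF u0(1)] u0 l0 by simp
      then obtain v where v: "v \<in> V" "c v = int i + 1" using full[OF u0(1)] by force
      then have "lo v = int i + 1"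
        using nested[OF u0(1) v(1)] h u0 lo_le[OF v(1)] le_hi[OF v(1)] by fastforce
      then have "f v \<le> i" using bd[OF v(1)] by (simp add: squeeze_def)
      moreover have "f u0 < f v" using ord(2)[OF u0(1) v(1)] v u0 h by simp
      ultimately show False using f0 by simp
    qed
    then show "f \<in> ?C" using fA u0 l0 f0 by blast
  qed
  show "?C \<subseteq> ?A - ?B"
    by (fastforce simp: fillings_def squeeze_def)
qed

lemma forest_poly_diff:
  assumes i: "i \<ge> 1"
  shows "forest_poly V c lo hi lo (ins_zero (Suc i) x) - forest_poly V c lo hi lo (ins_zero i x) =
    (\<Sum>f\<in>{f \<in> fillings V c lo hi (\<lambda>u. squeeze (Suc i) (lo u)). \<exists>u\<in>V. lo u = int i \<and> hi u = int i \<and> f u = i}.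
       \<Prod>u\<in>V. x (f u))"
proof -
  let ?A = "fillings V c lo hi (\<lambda>u. squeeze (Suc i) (lo u))" and ?B = "fillings V c lo hi (\<lambda>u. squeeze i (lo u))"
  have "?B \<subseteq> ?A" by (fastforce simp: fillings_def squeeze_def split: if_splits)
  then show ?thesis
    unfolding fillings_squeeze_Suc[OF i, symmetric]
    unfolding forest_poly_ins_zero[OF finite_V i] forest_poly_ins_zero[OF finite_V le_SucI[OF i]]
    using finite_V by (simp add: forest_poly_def sum_diff finite_fillings)
qed

text \<open>The surviving fillings have the value \<open>i\<close> at the leaf, which gives the
  factor \<open>x i\<close> that \<open>trim\<close> divides by. Deleting the leaf loses no
  constraint: with the bounds \<open>lo' i\<close>, the value \<open>i\<close> there already
  satisfies every order condition towards the ancestors of \<open>u0\<close>.\<close>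

lemma trim_forest_poly_leaf:
  assumes u0: "u0 \<in> V" "lo u0 = int i" "hi u0 = int i" and i: "i \<ge> 1" and x: "x i \<noteq> 0"
  shows "trim i (forest_poly V c lo hi lo) x = forest_poly (V - {u0}) (c' i) (lo' i) (hi' i) (lo' i) x"
proof -
  have c0: "c u0 = int i" using lo_le[OF u0(1)] le_hi[OF u0(1)] u0 by simp
  let ?A = "fillings V c lo hi (lo' i)"
  have "(\<Sum>f\<in>{f \<in> ?A. \<exists>u\<in>V. lo u = int i \<and> hi u = int i \<and> f u = i}. \<Prod>u\<in>V. x (f u)) =
    (\<Sum>f\<in>fillings (V - {u0}) c lo hi (lo' i). x i * (\<Prod>u\<in>V - {u0}. x (f u)))"
  proof (rule sum.reindex_bij_witness[of _ "\<lambda>f. f(u0 := i)" "\<lambda>f. f(u0 := undefined)"])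
    fix f assume "f \<in> {f \<in> ?A. \<exists>u\<in>V. lo u = int i \<and> hi u = int i \<and> f u = i}"
    then obtain u where f: "f \<in> ?A" and u: "u \<in> V" "lo u = int i" "hi u = int i" "f u = i" by blast
    have "c u = int i" using lo_le[OF u(1)] le_hi[OF u(1)] u by simp
    then have "u = u0" using eq_if_c_eq u u0 c0 by simp
    then have f0: "f u0 = i" using u by simp
    show "(f(u0 := undefined))(u0 := i) = f" using f0 by auto
    show "f(u0 := undefined) \<in> fillings (V - {u0}) c lo hi (lo' i)"
      using f by (auto simp: fillings_def extensional_def)
    show "x i * (\<Prod>u\<in>V - {u0}. x ((f(u0 := undefined)) u)) = (\<Prod>u\<in>V. x (f u))"
      using finite_V u0(1) f0 by (subst prod.remove[of V u0]) (auto intro!: prod.cong)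
  next
    fix f assume f: "f \<in> fillings (V - {u0}) c lo hi (lo' i)"
    show "(f(u0 := i))(u0 := undefined) = f" using f by (auto simp: fillings_def extensional_def)
    \<comment> \<open>If \<open>u0\<close> lies to the left of its ancestor \<open>u\<close>, then
      \<open>lo u \<le> i\<close> bounds \<open>f u\<close> weakly; if it lies to the right, then
      \<open>lo u \<le> c u < i\<close> gives the strict inequality.\<close>
    have bd: "int (f u) \<le> lo' i u" if "u \<in> V" "u \<noteq> u0" for u using f that by (auto simp: fillings_def)
    have left: "f u \<le> i" if "u \<in> V" "u \<noteq> u0" "lo u \<le> c u0" for u
      using bd[OF that(1,2)] that(3) c0 by (auto simp: squeeze_def)
    have right: "f u < i" if "u \<in> V" "u \<noteq> u0" "c u < c u0" for u
      using bd[OF that(1,2)] that(3) c0 lo_le[OF that(1)] by (auto simp: squeeze_def split: if_splits)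
    have "f(u0 := i) \<in> ?A"
      using f u0 c0 i left right
      unfolding fillings_def by (auto simp: extensional_def squeeze_def[of _ "int i"])
    then show "f(u0 := i) \<in> {f \<in> ?A. \<exists>u\<in>V. lo u = int i \<and> hi u = int i \<and> f u = i}"
      using u0 by auto
  qed
  then show ?thesis
    unfolding trim_def forest_poly_diff[OF i]
    using x by (simp add: forest_poly_def fillings_trim[OF u0(1) c0] sum_distrib_left[symmetric])
qed

lemma trim_forest_poly_other:
  assumes "\<not> (\<exists>u\<in>V. lo u = int i \<and> hi u = int i)" and "i \<ge> 1"
  shows "trim i (forest_poly V c lo hi lo) x = 0"
proof -
  have "{f \<in> fillings V c lo hi (\<lambda>u. squeeze (Suc i) (lo u)). \<exists>u\<in>V. lo u = int i \<and> hi u = int i \<and> f u = i} = {}"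
    using assms(1) by blast
  then show ?thesis unfolding trim_def forest_poly_diff[OF assms(2)] by (simp only: sum.empty div_0)
qed

text \<open>Sort by the first entry. All other nodes come after it and thus lie outside its
  interval, so it is a leaf; conversely a leaf may be put in front of any linear extension of the
  rest.\<close>

lemma card_lin_exts:
  assumes "V \<noteq> {}"
  shows "card (lin_exts V c lo hi) = (\<Sum>u | u \<in> V \<and> lo u = hi u. card (lin_exts (V - {u}) c lo hi))"
proof -
  have "lin_exts V c lo hi = (\<Union>u\<in>{u \<in> V. lo u = hi u}. (#) u ` lin_exts (V - {u}) c lo hi)" (is "?L = ?R")
  proof (intro set_eqI iffI)
    fix W assume W: "W \<in> ?L"
    then obtain u W' where uW: "W = u # W'" using assms by (cases W) (auto simp: lin_exts_def)
    have u: "u \<in> V" and W': "set W' = V - {u}" using W uW by (auto simp: lin_exts_def)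
    have "{lo u..hi u} \<subseteq> {c u}"
      using full[OF u] W uW W' by (fastforce simp: lin_exts_def)
    moreover have "lo u \<in> {lo u..hi u}" "hi u \<in> {lo u..hi u}" using lo_le[OF u] le_hi[OF u] by auto
    ultimately have "lo u \<in> {c u}" "hi u \<in> {c u}" by blast+
    then have "lo u = hi u" by simp
    then show "W \<in> ?R" using W uW u W' by (auto simp: lin_exts_def)
  next
    fix W assume "W \<in> ?R"
    then obtain u W' where u: "u \<in> V" "lo u = hi u" "W = u # W'" "W' \<in> lin_exts (V - {u}) c lo hi" by blast
    then have "c u = lo u" using lo_le le_hi by fastforce
    then have "c v \<notin> {lo u..hi u}" if "v \<in> V - {u}" for v
      using inj_onD[OF inj_c, of v u] that u by auto
    then show "W \<in> ?L" using u by (auto simp: lin_exts_def)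
  qed
  also have "card \<dots> = (\<Sum>u | u \<in> V \<and> lo u = hi u. card ((#) u ` lin_exts (V - {u}) c lo hi))"
    using finite_V by (intro card_UN_disjoint) (auto simp: finite_lin_exts)
  also have "\<dots> = (\<Sum>u | u \<in> V \<and> lo u = hi u. card (lin_exts (V - {u}) c lo hi))"
    by (intro sum.cong refl card_image) auto
  finally show ?thesis .
qed

text \<open>Each filling contributes a monomial of degree \<open>card V\<close>, and the bound on
  \<open>lo\<close> keeps its indices within the \<open>card V + 1\<close> available
  coordinates.\<close>

lemma dsym_forest_poly_const:
  assumes "\<And>u. u \<in> V \<Longrightarrow> lo u \<le> int (Suc (card V))"
    and "finite X" "card X = Suc (card V)" "finite Y" "card Y = Suc (card V)"
  shows "dsym (X :: 'a::field set) (forest_poly V c lo hi lo) = dsym Y (forest_poly V c lo hi lo)"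
proof -
  obtain vs where vs: "distinct vs" "set vs = V" using finite_V finite_distinct_list by blast
  have *: "(\<lambda>x::nat \<Rightarrow> 'a::field. \<Prod>u\<in>V. x (f u)) = monom_at (map f vs)" for f
    using prod.distinct_set_conv_list[OF vs(1)] vs(2) by (auto simp: monom_at_def comp_def fun_eq_iff)
  have "dsym X (\<lambda>x. \<Prod>u\<in>V. x (f u)) = dsym Y (\<lambda>x. \<Prod>u\<in>V. x (f u))" if f: "f \<in> fillings V c lo hi lo" for f
  proof -
    have "set (map f vs) \<subseteq> {1..Suc (card V)}"
      using f vs assms(1) by (force simp: fillings_def)
    moreover have "length (map f vs) \<le> card V" using vs distinct_card by fastforce
    ultimately show ?thesis unfolding * using dsym_monom_at_const assms(2-) by metis
  qed
  then show ?thesis unfolding forest_poly_def dsym_sum by simp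
qed

end

text \<open>Both sides satisfy the same recursion over the leaves: \<open>dsym_insert_zero\<close>
  with the two computations of \<open>trim\<close> on the left, \<open>card_lin_exts\<close> on the
  right.\<close>

theorem dsym_forest_poly:
  fixes X :: "'a::field set"
  assumes inf: "infinite (UNIV :: 'a set)" and "indexed_forest V c lo hi" "finite X" "card X = Suc (card V)"
    "\<And>u. u \<in> V \<Longrightarrow> lo u \<le> int (Suc (card V))"
  shows "dsym X (forest_poly V c lo hi lo) =
    (if c ` V = {1..int (card V)} then of_nat (card (lin_exts V c lo hi)) else 0)"
  using assms(2-)
proof (induction "card V" arbitrary: V c lo hi X)
  case 0
  interpret indexed_forest V c lo hi by fact
  have V: "V = {}" using 0 finite_V by simp
  obtain x where "X = {x}" using 0 by (auto simp: card_1_singleton_iff)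
  moreover have "lin_exts V c lo hi = {[]}" "fillings V c lo hi lo = {\<lambda>_. undefined}"
    using V by (auto simp: lin_exts_def fillings_def)
  ultimately show ?case using V by (simp add: forest_poly_def dsym_def)
next
  case (Suc n)
  interpret indexed_forest V c lo hi by fact
  have V: "finite V" "card V = Suc n" "V \<noteq> {}" using finite_V Suc by auto
  \<comment> \<open>\<open>X\<close> need not contain \<open>0\<close>; by constancy it may be
    replaced by \<open>insert 0 Y\<close> for any set \<open>Y\<close> of \<open>n + 1\<close>
    nonzero elements.\<close>
  have "infinite (UNIV - {0 :: 'a})" using inf by simp
  then obtain Y :: "'a set" where Y: "finite Y" "card Y = Suc n" "0 \<notin> Y"
    using infinite_arbitrarily_large[of "UNIV - {0 :: 'a}" "Suc n"] by blast
  let ?g = "forest_poly V c lo hi lo :: (nat \<Rightarrow> 'a) \<Rightarrow> 'a"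
  let ?ans = "\<lambda>V c lo hi. if c ` V = {1..int (card V)} then of_nat (card (lin_exts V c lo hi)) else 0 :: 'a"
  have leaf: "dsym Y (trim i ?g) = (if c ` V = {1..int (card V)} then of_nat (card (lin_exts (V - {u}) c lo hi)) else 0)"
    if i: "i \<in> {1..Suc n}" and u: "u \<in> V" "lo u = int i" "hi u = int i" for i u
  proof -
    have c0: "c u = int i" using lo_le[OF u(1)] le_hi[OF u(1)] u by simp
    have "dsym Y (trim i ?g) = dsym Y (forest_poly (V - {u}) (c' i) (lo' i) (hi' i) (lo' i))"
      by (rule dsym_cong) (use i Y coord_ne_zero[of _ Y i] in \<open>auto intro!: trim_forest_poly_leaf u\<close>)
    also have "\<dots> = ?ans (V - {u}) (c' i) (lo' i) (hi' i)"
    proof (rule Suc.hyps(1))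
      show "n = card (V - {u})" using V u by simp
      show "indexed_forest (V - {u}) (c' i) (lo' i) (hi' i)" by (rule indexed_forest_trim[OF u])
      show "lo' i v \<le> int (Suc (card (V - {u})))" if "v \<in> V - {u}" for v
        using Suc.prems(4)[of v] that V u i by (auto simp: squeeze_def)
    qed (use Y V u in auto)
    \<comment> \<open>Among the label sets containing \<open>i\<close>, only \<open>{1..n+1}\<close>
      becomes \<open>{1..n}\<close> when \<open>i\<close> is deleted and the gap closed. So a wrong
      support stays wrong in every summand, and a right one stays right.\<close>
    also have "c' i ` (V - {u}) = {1..int (card (V - {u}))} \<longleftrightarrow> c ` V = {1..int (card V)}"
    proof -
      have ne: "c v \<noteq> int i" if "v \<in> V - {u}" for v
        using that u c0 inj_onD[OF inj_c, of v u] by auto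
      have cV: "c ` V = insert (int i) (c ` (V - {u}))" using u c0 by (metis image_insert insert_Diff)
      have cV': "c ` (V - {u}) = c ` V - {int i}"  using cV ne by auto
      have k: "card (V - {u}) = n" using V u by simp
      show ?thesis
      proof
        assume L: "c' i ` (V - {u}) = {1..int (card (V - {u}))}"
        show "c ` V = {1..int (card V)}"
        proof (intro set_eqI iffI)
          fix j assume "j \<in> c ` V"
          then consider "j = int i" | v where "v \<in> V - {u}" "j = c v" using cV by auto
          then show "j \<in> {1..int (card V)}"
          proof cases
            case 2
            then have "c' i v \<in> {1..int n}" using L k by auto
            then show ?thesis using 2 V ne[of v] i by (auto simp: squeeze_def split: if_splits)
          qed (use i V in auto)
        next
          fix j assume j: "j \<in> {1..int (card V)}"
          show "j \<in> c ` V"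
          proof (cases "j = int i")
            case False
            then have "squeeze (Suc i) j \<in> {1..int (card (V - {u}))}"
              using j i k V by (auto simp: squeeze_def)
            then obtain v where "v \<in> V - {u}" "squeeze (Suc i) j = c' i v" using L by blast
            then show ?thesis using False ne[of v] by (auto simp: squeeze_def split: if_splits)
          qed (use c0 u in \<open>auto intro!: image_eqI[of _ _ u]\<close>)
        qed
      next
        assume R: "c ` V = {1..int (card V)}"
        have "c' i ` (V - {u}) = squeeze (Suc i) ` ({1..int (Suc n)} - {int i})"
          using cV' R V by (metis image_image)
        also have "\<dots> = {1..int n}"
        proof (intro set_eqI iffI)
          fix j assume "j \<in> {1..int n}"
          then show "j \<in> squeeze (Suc i) ` ({1..int (Suc n)} - {int i})"
            using i by (intro image_eqI[of _ _ "if j < int i then j else j + 1"]) (auto simp: squeeze_def)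
        qed (use i in \<open>auto simp: squeeze_def split: if_splits\<close>)
        finally show "c' i ` (V - {u}) = {1..int (card (V - {u}))}" using k by simp
      qed
    qed
    also have "lin_exts (V - {u}) (c' i) (lo' i) (hi' i) = lin_exts (V - {u}) c lo hi"
      by (rule lin_exts_trim[OF u(1) c0])
    finally show ?thesis .
  qed
  have g: "?g y = ?g z" if "\<And>j. j \<in> {1..Suc (Suc n)} \<Longrightarrow> y j = z j" for y z
  proof -
    have "f u \<in> {1..Suc (Suc n)}" if "f \<in> fillings V c lo hi lo" "u \<in> V" for f u
      using that Suc.prems(4)[of u] V by (force simp: fillings_def)
    then show ?thesis unfolding forest_poly_def using that by (intro sum.cong prod.cong) auto
  qed
  have "dsym X ?g = dsym (insert 0 Y) ?g"
    using Suc.prems Y V by (intro dsym_forest_poly_const) auto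
  also have "\<dots> = (\<Sum>i=1..Suc n. dsym Y (trim i ?g))"
    by (rule dsym_insert_zero[OF Y(1,2) _ Y(3) g]) auto
  also have "\<dots> = (if c ` V = {1..int (card V)} then of_nat (card (lin_exts V c lo hi)) else 0)"
  proof (cases "c ` V = {1..int (card V)}")
    case False
    have "dsym Y (trim i ?g) = 0" if i: "i \<in> {1..Suc n}" for i
    proof (cases "\<exists>u\<in>V. lo u = int i \<and> hi u = int i")
      case True
      then show ?thesis using leaf[OF i] False by auto
    next
      case F: False
      then have "trim i ?g = (\<lambda>_. 0)" using trim_forest_poly_other[OF F] i by (auto simp: fun_eq_iff)
      then show ?thesis by (simp add: dsym_def)
    qed
    then show ?thesis using False by simp
  next
    case True
    let ?leaves = "{u \<in> V. lo u = hi u}"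
    have cl: "c u = lo u" if "u \<in> ?leaves" for u using that lo_le[of u] le_hi[of u] by auto
    have inj: "inj_on (\<lambda>u. nat (c u)) ?leaves"
    proof (rule inj_onI)
      fix u v assume uv: "u \<in> ?leaves" "v \<in> ?leaves" "nat (c u) = nat (c v)"
      have "c u \<in> {1..int (card V)}" "c v \<in> {1..int (card V)}" using uv True by auto
      then have "c u = c v" using uv by auto
      then show "u = v" using uv inj_c by (auto dest: inj_onD)
    qed
    \<comment> \<open>With the right support every leaf label occurs as a summation index, so no
      leaf is missed in the recursion for linear extensions.\<close>
    have sub: "(\<lambda>u. nat (c u)) ` ?leaves \<subseteq> {1..Suc n}"
    proof
      fix j assume "j \<in> (\<lambda>u. nat (c u)) ` ?leaves"
      then obtain u where u: "u \<in> V" "j = nat (c u)" by auto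
      then have "c u \<in> {1..int (card V)}" using True by auto
      then show "j \<in> {1..Suc n}" using V u by auto
    qed
    have "(\<Sum>i=1..Suc n. dsym Y (trim i ?g)) = (\<Sum>i\<in>(\<lambda>u. nat (c u)) ` ?leaves. dsym Y (trim i ?g))"
    proof (rule sum.mono_neutral_right[OF _ sub], simp, rule ballI)
      fix i assume i: "i \<in> {1..Suc n} - (\<lambda>u. nat (c u)) ` ?leaves"
      have "\<not> (\<exists>u\<in>V. lo u = int i \<and> hi u = int i)"
      proof
        assume "\<exists>u\<in>V. lo u = int i \<and> hi u = int i"
        then obtain u where u: "u \<in> ?leaves" "lo u = int i" by force
        then have "nat (c u) = i" using cl[of u] by (metis nat_int)
        then show False using i u by auto
      qed
      then have "trim i ?g = (\<lambda>_. 0)" using trim_forest_poly_other i by (auto simp: fun_eq_iff)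
      then show "dsym Y (trim i ?g) = 0" by (simp add: dsym_def)
    qed
    also have "\<dots> = (\<Sum>u\<in>?leaves. dsym Y (trim (nat (c u)) ?g))"
      by (subst sum.reindex[OF inj]) simp
    also have "\<dots> = (\<Sum>u\<in>?leaves. of_nat (card (lin_exts (V - {u}) c lo hi)))"
    proof (rule sum.cong[OF refl])
      fix u assume u: "u \<in> ?leaves"
      have "c u \<in> {1..int (card V)}" using u True by auto
      then have "nat (c u) \<in> {1..Suc n}" "int (nat (c u)) = c u" using V(2) by auto
      then show "dsym Y (trim (nat (c u)) ?g) = of_nat (card (lin_exts (V - {u}) c lo hi))"
        using u cl[OF u] by (subst leaf[of "nat (c u)" u]) (simp_all only: True if_True simp_thms mem_Collect_eq)
    qed
    also have "\<dots> = of_nat (card (lin_exts V c lo hi))"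
      using card_lin_exts[OF V(3)] by simp
    finally show ?thesis using True by simp
  qed
  finally show ?case .
qed

subsection \<open>Sums of slide polynomials\<close>

text \<open>In \<open>child\<close>, \<open>w\<close> stands for the child of \<open>u\<close> on
  the way to \<open>v\<close>. Letters are compared along edges only, as in the definition of a
  binary search labeling; nothing is assumed about \<open>l v\<close> for a deeper descendant
  \<open>v\<close>.\<close>

locale labeled_forest = indexed_forest V c lo hi for V :: "'v set" and c lo hi +
  fixes l :: "'v \<Rightarrow> zbar"
  assumes inj_l: "inj_on l V"
    and val_l: "u \<in> V \<Longrightarrow> val (l u) \<in> {lo u..hi u}"
    and child: "u \<in> V \<Longrightarrow> v \<in> V \<Longrightarrow> u \<noteq> v \<Longrightarrow> c v \<in> {lo u..hi u} \<Longrightarrow>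
      \<exists>w\<in>V. w \<noteq> u \<and> c w \<in> {lo u..hi u} \<and> c v \<in> {lo w..hi w} \<and>
        (c v < c u \<longrightarrow> c w < c u \<and> l w < l u) \<and> (c u < c v \<longrightarrow> c u < c w \<and> l u < l w)"
begin

text \<open>The order in which a word compatible with \<open>f\<close> must list the nodes: larger
  values first, and among equal values increasing letters, since a descent would force a strict
  drop.\<close>

definition before :: "('v \<Rightarrow> nat) \<Rightarrow> 'v \<Rightarrow> 'v \<Rightarrow> bool" where
  "before f u v \<longleftrightarrow> f v < f u \<or> f u = f v \<and> l u < l v"

lemma before_trans: "before f u v \<Longrightarrow> before f v w \<Longrightarrow> before f u w"
  by (auto simp: before_def)

text \<open>The bound by the value of the letter amounts to the bound by the left end of the interval,
  so that the sum over a class of words depends only on the shape of the forest.\<close>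

lemma filling_le_lo:
  assumes ord: "\<And>u v. u \<in> V \<Longrightarrow> v \<in> V \<Longrightarrow> lo u \<le> c v \<Longrightarrow> c v < c u \<Longrightarrow> f u \<le> f v"
      "\<And>u v. u \<in> V \<Longrightarrow> v \<in> V \<Longrightarrow> c u < c v \<Longrightarrow> c v \<le> hi u \<Longrightarrow> f u < f v"
    and bd: "\<And>u. u \<in> V \<Longrightarrow> int (f u) \<le> val (l u)"
    and "u \<in> V"
  shows "int (f u) \<le> lo u"
  using \<open>u \<in> V\<close>
proof (induction "nat (hi u - lo u)" arbitrary: u rule: less_induct)
  case less
  note u = \<open>u \<in> V\<close> and lu = lo_le[OF \<open>u \<in> V\<close>] and hu = le_hi[OF \<open>u \<in> V\<close>]
  \<comment> \<open>In the first and third case the bound is passed down from the node at the left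
    end of the interval, or right after it when \<open>u\<close> has no left child; the strictness
    to the right pays for the shift by one. Only at a leaf does the letter enter, where its value is
    forced to be \<open>lo u\<close>.\<close>
  consider "lo u < c u" | "lo u = c u" "hi u = c u" | "lo u = c u" "c u < hi u" using lu hu by linarith
  then show ?case
  proof cases
    case 1
    then have "lo u \<in> {lo u..hi u}" using hu by simp
    then obtain v where v: "v \<in> V" "c v = lo u" using full[OF u] by (metis imageE subsetD)
    have neq: "u \<noteq> v" using v 1 by auto
    have n: "lo u \<le> lo v" "hi v \<le> hi u" "c u \<notin> {lo v..hi v}"
      using nested[OF u v(1) neq] v 1 hu by auto
    have "hi v < c u" "lo v = lo u" using n lo_le[OF v(1)] v 1 by auto
    then have "int (f v) \<le> lo v" using less.hyps[of v] v n hu 1 by auto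
    then show ?thesis using ord(1)[OF u v(1)] v 1 \<open>lo v = lo u\<close> by simp
  next
    case 2
    then show ?thesis using bd[OF u] val_l[OF u] by simp
  next
    case 3
    then have "lo u + 1 \<in> {lo u..hi u}" by simp
    then obtain v where v: "v \<in> V" "c v = lo u + 1" using full[OF u] by (metis imageE subsetD)
    have neq: "u \<noteq> v" using v 3 by auto
    have n: "lo u \<le> lo v" "hi v \<le> hi u" "c u \<notin> {lo v..hi v}"
      using nested[OF u v(1) neq] v 3 hu by auto
    then have "lo v = lo u + 1" using lo_le[OF v(1)] le_hi[OF v(1)] v 3 by auto
    then have "int (f v) \<le> lo v" using less.hyps[of v] v n 3 by auto
    then show ?thesis using ord(2)[OF u v(1)] v 3 \<open>lo v = lo u + 1\<close> by simp
  qed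
qed

text \<open>Along an edge to the left the inequality is weak but the letter decreases, along an edge
  to the right it is strict; \<open>before\<close> then follows by transitivity along the path from
  \<open>u\<close> to \<open>v\<close>.\<close>

lemma before_if_filling:
  assumes f: "f \<in> fillings V c lo hi lo" and "u \<in> V" "v \<in> V" "u \<noteq> v" "c v \<in> {lo u..hi u}"
  shows "before f v u"
  using assms(2-)
proof (induction "nat (hi u - lo u)" arbitrary: u rule: less_induct)
  case less
  note u = \<open>u \<in> V\<close> and v = \<open>v \<in> V\<close>
  obtain w where w: "w \<in> V" "w \<noteq> u" "c w \<in> {lo u..hi u}" "c v \<in> {lo w..hi w}"
    "c v < c u \<longrightarrow> c w < c u \<and> l w < l u" "c u < c v \<longrightarrow> c u < c w \<and> l u < l w"
    using child[OF u v less.prems(3,4)] by blast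
  have "c v \<noteq> c u" using eq_if_c_eq u v less.prems by metis
  have "lo u \<le> c w \<longrightarrow> c w < c u \<longrightarrow> f u \<le> f w" "c u < c w \<longrightarrow> c w \<le> hi u \<longrightarrow> f u < f w"
    using f w(1) u by (simp_all add: fillings_def)
  then have wu: "before f w u"
    using w(3,5,6) \<open>c v \<noteq> c u\<close> unfolding before_def by (cases "c v < c u") auto
  show ?case
  proof (cases "w = v")
    case True
    then show ?thesis using wu by simp
  next
    case False
    have "lo u \<le> lo w \<and> hi w \<le> hi u \<and> c u \<notin> {lo w..hi w}"
      using nested[OF u w(1) _ w(3)] w by auto
    then have "nat (hi w - lo w) < nat (hi u - lo u)"
      using lo_le[OF u] le_hi[OF u] lo_le[OF w(1)] le_hi[OF w(1)] by (auto simp: nat_less_eq_zless)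
    then have "before f v w" using less.hyps[of w] w v False by auto
    then show ?thesis using wu before_trans by blast
  qed
qed

lemma filling_iff_before:
  "f \<in> fillings V c lo hi lo \<longleftrightarrow> f \<in> extensional V \<and> (\<forall>u\<in>V. 1 \<le> f u \<and> int (f u) \<le> val (l u)) \<and>
    (\<forall>u\<in>V. \<forall>v\<in>V. u \<noteq> v \<longrightarrow> c v \<in> {lo u..hi u} \<longrightarrow> before f v u)"
  (is "?L \<longleftrightarrow> ?R")
proof
  assume L: ?L
  then have "1 \<le> f u \<and> int (f u) \<le> val (l u)" if "u \<in> V" for u
    using val_l[OF that] that by (force simp: fillings_def)
  then show ?R using L before_if_filling[OF L] by (auto simp: fillings_def)
next
  assume R: ?R
  have 1: "f u \<le> f v" if "u \<in> V" "v \<in> V" "lo u \<le> c v" "c v < c u" for u v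
    using R that le_hi[of u] unfolding before_def by fastforce
  have 2: "f u < f v" if uv: "u \<in> V" "v \<in> V" "c u < c v" "c v \<le> hi u" for u v
  proof -
    \<comment> \<open>On an edge to the right the letter increases, so the tie in
      \<open>before f w u\<close> is impossible and the inequality is strict.\<close>
    obtain w where w: "w \<in> V" "w \<noteq> u" "c w \<in> {lo u..hi u}" "c v \<in> {lo w..hi w}" "l u < l w"
      using child[of u v] uv lo_le[of u] by force
    then have "f u < f w" using R uv unfolding before_def by fastforce
    moreover have "f w \<le> f v" using R w uv unfolding before_def by (cases "w = v") fastforce+
    ultimately show ?thesis by simp
  qed
  have 3: "int (f u) \<le> lo u" if "u \<in> V" for u
  proof (rule filling_le_lo)
    show "int (f v) \<le> val (l v)" if "v \<in> V" for v using R that by blast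
  qed (fact 1 2 that)+
  show ?L
    unfolding fillings_def
  proof (intro CollectI conjI ballI impI)
    show "f \<in> extensional V" using R by blast
    show "1 \<le> f u" if "u \<in> V" for u using R that by blast
  qed (fact 1 2 3)+
qed

definition compatible :: "'v list \<Rightarrow> ('v \<Rightarrow> nat) set" where
  "compatible ts = {f \<in> extensional V. (\<forall>u\<in>V. 1 \<le> f u \<and> int (f u) \<le> val (l u)) \<and> sorted_wrt (before f) ts}"

text \<open>As letters are distinct, the two conditions on neighbouring positions together say
  exactly \<open>before\<close>, and transitivity extends this to all pairs of positions.\<close>

lemma map_in_slide_seqs_iff:
  assumes ts: "distinct ts" "set ts = V"
  shows "map f ts \<in> slide_seqs (map l ts) \<longleftrightarrow>
    (\<forall>u\<in>V. 1 \<le> f u \<and> int (f u) \<le> val (l u)) \<and> sorted_wrt (before f) ts"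
proof -
  have tr: "transp (before f)" by (meson before_trans transpI)
  have "l (ts ! j) \<noteq> l (ts ! Suc j)" if "Suc j < length ts" for j
    using that ts inj_onD[OF inj_l, of "ts ! j" "ts ! Suc j"] nth_eq_iff_index_eq[OF ts(1), of j "Suc j"]
    by (auto simp: ts(2)[symmetric])
  then have "(f (ts ! Suc j) \<le> f (ts ! j) \<and> (l (ts ! Suc j) < l (ts ! j) \<longrightarrow> f (ts ! Suc j) < f (ts ! j))) \<longleftrightarrow>
      before f (ts ! j) (ts ! Suc j)" if "Suc j < length ts" for j
    using that unfolding before_def by (metis le_less less_le_not_le linorder_neqE)
  then show ?thesis
    unfolding slide_seqs_def sorted_wrt_iff_nth_Suc_transp[OF tr] ts(2)[symmetric] all_set_conv_all_nth
    by (auto simp: Suc_lessD)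
qed

lemma sum_slide_seqs_eq_sum_compatible:
  assumes ts: "distinct ts" "set ts = V"
  shows "(\<Sum>a\<in>slide_seqs (map l ts). \<Prod>j<length ts. x (a ! j)) = (\<Sum>f\<in>compatible ts. \<Prod>u\<in>V. (x (f u) :: 'a::field))"
proof -
  have bij: "bij_betw (\<lambda>f. map f ts) (compatible ts) (slide_seqs (map l ts))"
  proof (rule bij_betw_imageI)
    show "inj_on (\<lambda>f. map f ts) (compatible ts)"
    proof (rule inj_onI)
      fix f g assume "f \<in> compatible ts" "g \<in> compatible ts" "map f ts = map g ts"
      then show "f = g" using ts by (intro extensionalityI[of f V g]) (auto simp: compatible_def)
    qed
    show "(\<lambda>f. map f ts) ` compatible ts = slide_seqs (map l ts)"
    proof (intro equalityI subsetI)
      fix a assume "a \<in> (\<lambda>f. map f ts) ` compatible ts"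
      then show "a \<in> slide_seqs (map l ts)"
        using map_in_slide_seqs_iff[OF ts] by (auto simp: compatible_def)
    next
      fix a assume a: "a \<in> slide_seqs (map l ts)"
      define f where "f = restrict (\<lambda>u. the (map_of (zip ts a) u)) V"
      have len: "length a = length ts" using a by (simp add: slide_seqs_def)
      have "map f ts = a"
        using len ts by (intro nth_equalityI) (auto simp: f_def map_of_zip_nth)
      moreover have "f \<in> compatible ts"
        using map_in_slide_seqs_iff[OF ts, of f] a calculation by (simp add: compatible_def f_def)
      ultimately show "a \<in> (\<lambda>f. map f ts) ` compatible ts" by blast
    qed
  qed
  have "(\<Sum>f\<in>compatible ts. \<Prod>j<length ts. x (map f ts ! j)) = (\<Sum>f\<in>compatible ts. \<Prod>u\<in>V. x (f u))"
  proof (rule sum.cong[OF refl])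
    fix f
    have "(\<Prod>j<length ts. x (map f ts ! j)) = prod_list (map (\<lambda>u. x (f u)) ts)"
      by (simp add: prod.list_conv_set_nth atLeast0LessThan)
    then show "(\<Prod>j<length ts. x (map f ts ! j)) = (\<Prod>u\<in>V. x (f u))"
      using prod.distinct_set_conv_list[OF ts(1), of "\<lambda>u. x (f u)"] ts(2) by simp
  qed
  then show ?thesis
    using sum.reindex_bij_betw[OF bij, of "\<lambda>a. \<Prod>j<length ts. x (a ! j)"] by simp
qed

text \<open>For each \<open>f\<close>, \<open>before f\<close> is the strict order pulled back along
  the injective key \<open>(- f u, l u)\<close>, so sorting by the key gives the only such list.
  This makes the sets \<open>compatible ts\<close> disjoint.\<close>

lemma ex1_sorted_before: "\<exists>!ts. distinct ts \<and> set ts = V \<and> sorted_wrt (before f) ts"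
proof -
  define key where "key u = (- int (f u), l u)" for u
  have key: "before f u v \<longleftrightarrow> key u < key v" for u v by (auto simp: before_def key_def)
  have inj: "inj_on key V" using inj_l by (auto simp: key_def inj_on_def)
  have srt: "sorted_wrt (before f) ts \<longleftrightarrow> sorted_wrt (<) (map key ts)" for ts
    by (simp add: sorted_wrt_map key[abs_def])
  obtain xs where xs: "sorted_wrt (<) xs" "set xs = key ` V"
    using ex1_sorted_list_for_set_if_finite[of "key ` V"] finite_V by blast
  define ts where "ts = map (inv_into V key) xs"
  have k: "map key ts = xs" using xs by (auto simp: ts_def f_inv_into_f intro!: map_idI)
  have "set ts = V" using xs inj by (simp add: ts_def image_image[symmetric] inv_into_image_cancel)
  moreover have "sorted_wrt (before f) ts" using srt k xs by simp
  moreover have "distinct ts" using k xs strict_sorted_iff by (metis distinct_map)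
  ultimately have "\<exists>ts. distinct ts \<and> set ts = V \<and> sorted_wrt (before f) ts" by blast
  moreover have "ts = ts'" if "set ts = V" "sorted_wrt (before f) ts" "set ts' = V" "sorted_wrt (before f) ts'" for ts ts'
  proof -
    have "map key ts = map key ts'"
      using that srt by (intro strict_sorted_equal) auto
    then show ?thesis using inj that by (metis inj_on_map_eq_map Un_absorb)
  qed
  ultimately show ?thesis by blast
qed

lemma mem_lin_exts_iff:
  assumes ts: "distinct ts" "set ts = V" "sorted_wrt (before f) ts"
  shows "ts \<in> lin_exts V c lo hi \<longleftrightarrow> (\<forall>u\<in>V. \<forall>v\<in>V. u \<noteq> v \<longrightarrow> c v \<in> {lo u..hi u} \<longrightarrow> before f v u)"
proof
  assume L: "ts \<in> lin_exts V c lo hi"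
  show "\<forall>u\<in>V. \<forall>v\<in>V. u \<noteq> v \<longrightarrow> c v \<in> {lo u..hi u} \<longrightarrow> before f v u"
  proof (intro ballI impI)
    fix u v assume uv: "u \<in> V" "v \<in> V" "u \<noteq> v" "c v \<in> {lo u..hi u}"
    then obtain i j where ij: "i < length ts" "j < length ts" "u = ts ! i" "v = ts ! j"
      using ts by (metis in_set_conv_nth)
    have "\<not> i < j" using L ij uv sorted_wrt_nth_less[of _ ts i j] by (fastforce simp: lin_exts_def)
    then have "j < i" using ij uv by (metis linorder_neqE_nat)
    then show "before f v u" using ij ts sorted_wrt_nth_less by metis
  qed
next
  assume R: "\<forall>u\<in>V. \<forall>v\<in>V. u \<noteq> v \<longrightarrow> c v \<in> {lo u..hi u} \<longrightarrow> before f v u"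
  have "c (ts ! j) \<notin> {lo (ts ! i)..hi (ts ! i)}" if "i < j" "j < length ts" for i j
  proof
    assume "c (ts ! j) \<in> {lo (ts ! i)..hi (ts ! i)}"
    moreover have "ts ! i \<noteq> ts ! j" using that ts nth_eq_iff_index_eq[OF ts(1)] by auto
    ultimately have "before f (ts ! j) (ts ! i)" using R that ts(2) by auto
    moreover have "before f (ts ! i) (ts ! j)" using that ts(3) sorted_wrt_nth_less by metis
    ultimately show False by (auto simp: before_def)
  qed
  then show "ts \<in> lin_exts V c lo hi"
    using ts unfolding lin_exts_def by (simp add: sorted_wrt_iff_nth_less)
qed

text \<open>The fundamental lemma on \<open>P\<close>-partitions: each filling is compatible with
  exactly one ordering of the nodes, and that ordering is a linear extension precisely because of
  the order conditions on the filling.\<close>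

lemma sum_slides_eq_forest_poly:
  "(\<Sum>ts\<in>lin_exts V c lo hi. \<Sum>a\<in>slide_seqs (map l ts). \<Prod>j<length ts. x (a ! j)) =
    (forest_poly V c lo hi lo x :: 'a::field)"
proof -
  let ?S = "Sigma (lin_exts V c lo hi) compatible"
  have fin: "finite (compatible ts)" for ts
  proof (rule finite_subset)
    show "compatible ts \<subseteq> PiE V (\<lambda>u. {..nat (val (l u))})"
      unfolding compatible_def PiE_def Pi_def using nat_le_iff by fastforce
    show "finite (PiE V (\<lambda>u. {..nat (val (l u))}))" using finite_V by (intro finite_PiE) auto
  qed
  have "(\<Sum>ts\<in>lin_exts V c lo hi. \<Sum>a\<in>slide_seqs (map l ts). \<Prod>j<length ts. x (a ! j)) =
    (\<Sum>ts\<in>lin_exts V c lo hi. \<Sum>f\<in>compatible ts. \<Prod>u\<in>V. x (f u))"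
    by (intro sum.cong refl sum_slide_seqs_eq_sum_compatible) (auto simp: lin_exts_def)
  also have "\<dots> = (\<Sum>p\<in>?S. \<Prod>u\<in>V. x (snd p u))"
    by (subst sum.Sigma) (auto simp: finite_lin_exts finite_V fin case_prod_unfold)
  also have "\<dots> = forest_poly V c lo hi lo x"
    unfolding forest_poly_def
  proof (rule sum.reindex_bij_betw)
    show "bij_betw snd ?S (fillings V c lo hi lo)"
    proof (rule bij_betw_imageI)
      show "inj_on snd ?S"
      proof (rule inj_onI)
        fix p q assume pq: "p \<in> ?S" "q \<in> ?S" "snd p = snd q"
        have "distinct (fst r) \<and> set (fst r) = V \<and> sorted_wrt (before (snd r)) (fst r)" if "r \<in> ?S" for r
          using that by (cases r) (simp add: lin_exts_def compatible_def)
        then have "fst p = fst q"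
          using pq ex1_sorted_before[of "snd p"] by metis
        then show "p = q" using pq by (simp add: prod_eq_iff)
      qed
      show "snd ` ?S = fillings V c lo hi lo"
      proof (intro equalityI subsetI)
        fix f assume "f \<in> snd ` ?S"
        then obtain ts where ts: "ts \<in> lin_exts V c lo hi" "f \<in> compatible ts" by auto
        then have "\<forall>u\<in>V. \<forall>v\<in>V. u \<noteq> v \<longrightarrow> c v \<in> {lo u..hi u} \<longrightarrow> before f v u"
          using mem_lin_exts_iff[of ts f] by (simp add: lin_exts_def compatible_def)
        then show "f \<in> fillings V c lo hi lo"
          using ts unfolding filling_iff_before by (simp add: compatible_def)
      next
        fix f assume f: "f \<in> fillings V c lo hi lo"
        obtain ts where ts: "distinct ts" "set ts = V" "sorted_wrt (before f) ts"
          using ex1_sorted_before[of f] by blast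
        then have "ts \<in> lin_exts V c lo hi" "f \<in> compatible ts"
          using f mem_lin_exts_iff[of ts f] unfolding filling_iff_before by (auto simp: compatible_def)
        then show "f \<in> snd ` ?S" by force
      qed
    qed
  qed
  finally show ?thesis .
qed

end

subsection \<open>The insertion forest\<close>

type_synonym ltree = "(int \<times> zbar) tree"

fun ctr :: "ltree \<Rightarrow> int" where
  "ctr (Node l (c, a) r) = c"
| "ctr Leaf = 0"

fun lo_end :: "ltree \<Rightarrow> int" where
  "lo_end (Node l (c, a) r) = c - int (size l)"
| "lo_end Leaf = 0"

fun hi_end :: "ltree \<Rightarrow> int" where
  "hi_end (Node l (c, a) r) = c + int (size r)"
| "hi_end Leaf = 0"

fun wf_tree :: "ltree \<Rightarrow> bool" where
  "wf_tree Leaf \<longleftrightarrow> True"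
| "wf_tree (Node l (c, a) r) \<longleftrightarrow> wf_tree l \<and> wf_tree r \<and>
    (l \<noteq> Leaf \<longrightarrow> hi_end l = c - 1 \<and> root_letter l < a) \<and>
    (r \<noteq> Leaf \<longrightarrow> lo_end r = c + 1 \<and> a < root_letter r) \<and>
    val a \<in> {c - int (size l)..c + int (size r)}"

text \<open>A node is represented by the whole subtree below it, so its label, interval, letter and
  descendants can all be read off from it.\<close>

definition nodes :: "ltree \<Rightarrow> ltree set" where
  "nodes t = subtrees t - {Leaf}"

definition forest_nodes :: "lforest \<Rightarrow> ltree set" where
  "forest_nodes F = (\<Union>T\<in>F. nodes T)"

text \<open>The gap of at least one between trees makes the block of each tree a maximal interval of
  the support.\<close>

definition wf_forest :: "lforest \<Rightarrow> bool" where
  "wf_forest F \<longleftrightarrow> finite F \<and> Leaf \<notin> F \<and> (\<forall>T\<in>F. wf_tree T) \<and>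
    (\<forall>T\<in>F. \<forall>T'\<in>F. T \<noteq> T' \<longrightarrow> hi_end T + 1 < lo_end T' \<or> hi_end T' + 1 < lo_end T) \<and>
    inj_on root_letter (forest_nodes F)"

lemma nodes_Leaf [simp]: "nodes Leaf = {}"
  by (simp add: nodes_def)

lemma nodes_Node [simp]: "nodes (Node l p r) = insert (Node l p r) (nodes l \<union> nodes r)"
  by (auto simp: nodes_def)

lemma finite_nodes: "finite (nodes t)"
  by (induction t) auto

lemma self_in_nodes: "t \<noteq> Leaf \<Longrightarrow> t \<in> nodes t"
  by (cases t) auto

lemma nodes_ne_Leaf: "u \<in> nodes t \<Longrightarrow> u \<noteq> Leaf"
  by (simp add: nodes_def)

lemma nodes_trans: "u \<in> nodes t \<Longrightarrow> nodes u \<subseteq> nodes t"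
  by (induction t) auto

lemma wf_tree_nodes: "wf_tree t \<Longrightarrow> u \<in> nodes t \<Longrightarrow> wf_tree u"
proof (induction t)
  case (Node l p r)
  then show ?case by (cases p) auto
qed simp

lemma size_nodes: "u \<in> nodes t \<Longrightarrow> size u \<le> size t"
  by (induction t) auto

lemma tree_supp_Leaf [simp]: "tree_supp Leaf = {}"
  by (simp add: tree_supp_def)

lemma tree_supp_Node [simp]: "tree_supp (Node l (c, a) r) = insert c (tree_supp l \<union> tree_supp r)"
  by (auto simp: tree_supp_def)

lemma ctr_image_nodes: "ctr ` nodes t = tree_supp t"
proof (induction t)
  case (Node l p r)
  then show ?case by (cases p) (auto simp: image_Un)
qed simp

lemma Supp_eq: "Supp F = ctr ` forest_nodes F"
  by (simp add: Supp_def forest_nodes_def image_UN ctr_image_nodes)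

lemma hi_end_eq: "t \<noteq> Leaf \<Longrightarrow> hi_end t = lo_end t + int (size t) - 1"
  by (cases t rule: hi_end.cases) auto

lemma lo_le_hi: "t \<noteq> Leaf \<Longrightarrow> lo_end t \<le> ctr t \<and> ctr t \<le> hi_end t"
  by (cases t rule: hi_end.cases) auto

lemma tree_supp_eq: "wf_tree t \<Longrightarrow> t \<noteq> Leaf \<Longrightarrow> tree_supp t = {lo_end t..hi_end t}"
proof (induction t)
  case (Node l p r)
  obtain c a where p: "p = (c, a)" by force
  have L: "tree_supp l = {c - int (size l)..c - 1}"
  proof (cases "l = Leaf")
    case False
    then show ?thesis using Node p hi_end_eq[of l] by auto
  qed simp
  have R: "tree_supp r = {c + 1..c + int (size r)}"
  proof (cases "r = Leaf")
    case False
    then show ?thesis using Node p hi_end_eq[of r] by auto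
  qed simp
  show ?case unfolding p tree_supp_Node L R by auto
qed simp

lemma tree_supp_children:
  assumes "wf_tree (Node l (c, a) r)"
  shows "tree_supp l = {c - int (size l)..c - 1}" "tree_supp r = {c + 1..c + int (size r)}"
proof -
  show "tree_supp l = {c - int (size l)..c - 1}"
    using assms tree_supp_eq[of l] hi_end_eq[of l] by (cases "l = Leaf") auto
  show "tree_supp r = {c + 1..c + int (size r)}"
    using assms tree_supp_eq[of r] hi_end_eq[of r] by (cases "r = Leaf") auto
qed

lemma inj_on_ctr_nodes: "wf_tree t \<Longrightarrow> inj_on ctr (nodes t)"
proof (induction t)
  case (Node l p r)
  obtain c a where p: "p = (c, a)" by force
  note S = tree_supp_children[OF Node.prems[unfolded p]]
  have "ctr ` nodes l \<inter> ctr ` nodes r = {}" "c \<notin> ctr ` nodes l" "c \<notin> ctr ` nodes r"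
    unfolding ctr_image_nodes S by auto
  moreover have "inj_on ctr (nodes l)" "inj_on ctr (nodes r)" using Node p by auto
  ultimately show ?case unfolding p nodes_Node inj_on_insert inj_on_Un by auto
qed simp

lemma ctr_interval_nodes: "wf_tree u \<Longrightarrow> u \<noteq> Leaf \<Longrightarrow> ctr ` nodes u = {lo_end u..hi_end u}"
  by (simp add: ctr_image_nodes tree_supp_eq)

lemma nodes_interval:
  assumes "wf_tree t" "u \<in> nodes t"
  shows "lo_end t \<le> lo_end u" "hi_end u \<le> hi_end t"
proof -
  have ne: "t \<noteq> Leaf" "u \<noteq> Leaf" using assms nodes_ne_Leaf by auto
  have "ctr ` nodes u \<subseteq> ctr ` nodes t" using nodes_trans[OF assms(2)] by blast
  then have "{lo_end u..hi_end u} \<subseteq> {lo_end t..hi_end t}"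
    using assms ne wf_tree_nodes by (simp add: ctr_interval_nodes)
  then show "lo_end t \<le> lo_end u" "hi_end u \<le> hi_end t" using lo_le_hi[OF ne(2)] by auto
qed

section \<open>A well-formed forest as an instance of the labeled forests above\<close>

context
  fixes F :: lforest
  assumes wf: "wf_forest F"
begin

lemma wf_forestD:
  shows "finite F" "Leaf \<notin> F" "T \<in> F \<Longrightarrow> wf_tree T" "T \<in> F \<Longrightarrow> T \<noteq> Leaf"
    "T \<in> F \<Longrightarrow> T' \<in> F \<Longrightarrow> T \<noteq> T' \<Longrightarrow> hi_end T + 1 < lo_end T' \<or> hi_end T' + 1 < lo_end T"
    "inj_on root_letter (forest_nodes F)" "T \<in> F \<Longrightarrow> tree_supp T = {lo_end T..hi_end T}"
  using wf tree_supp_eq[of T] unfolding wf_forest_def by blast+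

lemma tree_eq_if_meet:
  assumes "T \<in> F" "T' \<in> F" "i \<in> tree_supp T" "i \<in> tree_supp T'"
  shows "T = T'"
  using assms wf_forestD(5)[of T T'] wf_forestD(7)[of T] wf_forestD(7)[of T'] by fastforce

lemma wf_tree_forest_nodes: "u \<in> forest_nodes F \<Longrightarrow> wf_tree u"
  using wf_forestD(3) wf_tree_nodes by (auto simp: forest_nodes_def)

lemma forest_nodes_ne_Leaf: "u \<in> forest_nodes F \<Longrightarrow> u \<noteq> Leaf"
  using nodes_ne_Leaf by (auto simp: forest_nodes_def)

lemma forest_nodes_trans: "u \<in> forest_nodes F \<Longrightarrow> nodes u \<subseteq> forest_nodes F"
  using nodes_trans by (fastforce simp: forest_nodes_def)

lemma inj_on_ctr: "inj_on ctr (forest_nodes F)"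
proof (rule inj_onI)
  fix u v assume uv: "u \<in> forest_nodes F" "v \<in> forest_nodes F" "ctr u = ctr v"
  then obtain T T' where T: "T \<in> F" "u \<in> nodes T" "T' \<in> F" "v \<in> nodes T'" by (auto simp: forest_nodes_def)
  then have "ctr u \<in> tree_supp T" "ctr u \<in> tree_supp T'"
    using uv(3) by (metis ctr_image_nodes imageI)+
  then have "T = T'" using tree_eq_if_meet T by blast
  then show "u = v" using T uv inj_on_ctr_nodes[OF wf_forestD(3)[of T]] by (auto dest: inj_onD)
qed

lemma in_nodes_iff:
  assumes "u \<in> forest_nodes F" "v \<in> forest_nodes F"
  shows "ctr v \<in> {lo_end u..hi_end u} \<longleftrightarrow> v \<in> nodes u"
proof -
  have "ctr ` nodes u = {lo_end u..hi_end u}"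
    using assms wf_tree_forest_nodes forest_nodes_ne_Leaf ctr_interval_nodes by blast
  moreover have "ctr v \<in> ctr ` nodes u \<longleftrightarrow> v \<in> nodes u"
    using inj_on_image_mem_iff[OF inj_on_ctr assms(2)] forest_nodes_trans assms by blast
  ultimately show ?thesis by simp
qed

lemma labeled_forest_nodes: "labeled_forest (forest_nodes F) ctr lo_end hi_end root_letter"
proof
  show "finite (forest_nodes F)" using wf_forestD(1) finite_nodes by (auto simp: forest_nodes_def)
  show "inj_on ctr (forest_nodes F)" by (rule inj_on_ctr)
  show "inj_on root_letter (forest_nodes F)" by (rule wf_forestD(6))
  fix u assume u: "u \<in> forest_nodes F"
  then have wfu: "wf_tree u" "u \<noteq> Leaf" using wf_tree_forest_nodes forest_nodes_ne_Leaf by blast+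
  show "lo_end u \<le> ctr u" "ctr u \<le> hi_end u" using lo_le_hi[OF wfu(2)] by auto
  obtain l c a r where ur: "u = Node l (c, a) r" using wfu(2) by (cases u) auto
  show "val (root_letter u) \<in> {lo_end u..hi_end u}" using wfu ur by simp
  show "{lo_end u..hi_end u} \<subseteq> ctr ` forest_nodes F"
    using ctr_interval_nodes[OF wfu] forest_nodes_trans[OF u] by blast
  fix v assume v: "v \<in> forest_nodes F" "u \<noteq> v" "ctr v \<in> {lo_end u..hi_end u}"
  then have vu: "v \<in> nodes u" using in_nodes_iff[OF u v(1)] by simp
  have "size v < size u" using vu v(2) ur size_nodes[of v l] size_nodes[of v r] by auto
  then have "u \<notin> nodes v" using size_nodes[of u v] by auto
  then show "lo_end u \<le> lo_end v \<and> hi_end v \<le> hi_end u \<and> ctr u \<notin> {lo_end v..hi_end v}"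
    using nodes_interval[OF wfu(1) vu] in_nodes_iff[OF v(1) u] by simp
  \<comment> \<open>The child of \<open>u\<close> whose subtree contains \<open>v\<close>.\<close>
  define w where "w = (if v \<in> nodes l then l else r)"
  have vw: "v \<in> nodes w" using vu v(2) ur by (auto simp: w_def)
  then have wne: "w \<noteq> Leaf" by auto
  have wu: "w \<in> nodes u" using vw ur self_in_nodes[OF wne] by (auto simp: w_def)
  have w: "w \<in> forest_nodes F" using forest_nodes_trans[OF u] wu by blast
  have S: "tree_supp l = {c - int (size l)..c - 1}" "tree_supp r = {c + 1..c + int (size r)}"
    using tree_supp_children[OF wfu(1)[unfolded ur]] by auto
  have cc: "ctr w \<in> tree_supp w" "ctr v \<in> tree_supp w"
    using vw self_in_nodes[OF wne] by (auto simp flip: ctr_image_nodes)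
  have "size w < size u" using ur by (auto simp: w_def)
  then have "w \<noteq> u" by auto
  moreover have "ctr w \<in> {lo_end u..hi_end u}" using in_nodes_iff[OF u w] wu by simp
  moreover have "ctr v \<in> {lo_end w..hi_end w}" using in_nodes_iff[OF w v(1)] vw by simp
  moreover have "(ctr v < ctr u \<longrightarrow> ctr w < ctr u \<and> root_letter w < root_letter u) \<and>
    (ctr u < ctr v \<longrightarrow> ctr u < ctr w \<and> root_letter u < root_letter w)"
    using cc S wne wfu(1) unfolding w_def by (auto simp: ur split: if_splits)
  ultimately show "\<exists>w\<in>forest_nodes F. w \<noteq> u \<and> ctr w \<in> {lo_end u..hi_end u} \<and> ctr v \<in> {lo_end w..hi_end w} \<and>
      (ctr v < ctr u \<longrightarrow> ctr w < ctr u \<and> root_letter w < root_letter u) \<and>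
      (ctr u < ctr v \<longrightarrow> ctr u < ctr w \<and> root_letter u < root_letter w)"
    using w by blast
qed

lemma tree_at_eq: "T \<in> F \<Longrightarrow> i \<in> tree_supp T \<Longrightarrow> tree_at F i = T"
  unfolding tree_at_def using tree_eq_if_meet by (auto simp: Supp_def intro!: the_equality)

lemma tree_at_in: "i \<in> Supp F \<Longrightarrow> tree_at F i \<in> F \<and> i \<in> tree_supp (tree_at F i)"
  using tree_at_eq by (auto simp: Supp_def)

lemma tree_at_ne_Leaf_iff: "tree_at F i \<noteq> Leaf \<longleftrightarrow> i \<in> Supp F"
  using tree_at_in[of i] wf_forestD(2) by (auto simp: tree_at_def)

lemma max_interval_Supp:
  assumes T: "T \<in> F" "i \<in> tree_supp T"
  shows "max_interval (Supp F) i = tree_supp T"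
proof -
  have ST: "tree_supp T = {lo_end T..hi_end T}" using wf_forestD(7) T by blast
  have out: "j \<notin> Supp F" if "j = hi_end T + 1 \<or> j = lo_end T - 1" for j
  proof
    assume "j \<in> Supp F"
    then obtain T' where T': "T' \<in> F" "j \<in> tree_supp T'" by (auto simp: Supp_def)
    then have "T' \<noteq> T" using that ST by auto
    then show False using wf_forestD(5)[OF T'(1) T(1)] T'(2) wf_forestD(7)[OF T'(1)] that lo_le_hi[OF wf_forestD(4)[OF T(1)]] by auto
  qed
  show ?thesis
  proof (intro set_eqI iffI)
    fix j assume "j \<in> max_interval (Supp F) i"
    then have sub: "{min i j..max i j} \<subseteq> Supp F" by (simp add: max_interval_def)
    have "hi_end T + 1 \<notin> {min i j..max i j}" "lo_end T - 1 \<notin> {min i j..max i j}"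
      using out sub by blast+
    then show "j \<in> tree_supp T" using T(2) ST by (auto simp: min_def max_def split: if_splits)
  next
    fix j assume "j \<in> tree_supp T"
    then have "{min i j..max i j} \<subseteq> tree_supp T" using T(2) ST by auto
    then show "j \<in> max_interval (Supp F) i" using T(1) by (auto simp: max_interval_def Supp_def)
  qed
qed

end

section \<open>Insertion as grafting of a root, and its inverse\<close>

definition graftable :: "lforest \<Rightarrow> int \<Rightarrow> zbar \<Rightarrow> bool" where
  "graftable F c a \<longleftrightarrow> (let L = tree_at F (c - 1); R = tree_at F (c + 1) in
    c \<notin> Supp F \<and> a \<notin> root_letter ` forest_nodes F \<and> (L \<noteq> Leaf \<longrightarrow> root_letter L < a) \<and>
    (R \<noteq> Leaf \<longrightarrow> a < root_letter R) \<and> val a \<in> {c - int (size L)..c + int (size R)})"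

lemma graft_props:
  assumes wf: "wf_forest F" and g: "graftable F c a"
  defines "L \<equiv> tree_at F (c - 1)" and "R \<equiv> tree_at F (c + 1)"
  shows "wf_forest (graft F L c a R)"
    and "forest_nodes (graft F L c a R) = insert (Node L (c, a) R) (forest_nodes F)"
    and "wf_tree (Node L (c, a) R)"
    and "\<And>T. T \<in> F - {L, R} \<Longrightarrow> tree_supp T \<inter> tree_supp (Node L (c, a) R) = {}"
proof -
  let ?N = "Node L (c, a) R"
  note wfD = wf_forestD[OF wf]
  have g': "c \<notin> Supp F" "a \<notin> root_letter ` forest_nodes F" "L \<noteq> Leaf \<Longrightarrow> root_letter L < a"
    "R \<noteq> Leaf \<Longrightarrow> a < root_letter R" "val a \<in> {c - int (size L)..c + int (size R)}"
    using g by (auto simp: graftable_def Let_def L_def R_def)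
  have L: "L \<in> F \<and> hi_end L = c - 1" if "L \<noteq> Leaf"
  proof -
    have "L \<in> F" "c - 1 \<in> tree_supp L"
      using that tree_at_ne_Leaf_iff[OF wf] tree_at_in[OF wf, of "c - 1"] unfolding L_def by auto
    moreover have "c \<notin> tree_supp L" using g' calculation by (auto simp: Supp_def)
    ultimately show ?thesis using wfD(7)[of L] by auto
  qed
  have R: "R \<in> F \<and> lo_end R = c + 1" if "R \<noteq> Leaf"
  proof -
    have "R \<in> F" "c + 1 \<in> tree_supp R"
      using that tree_at_ne_Leaf_iff[OF wf] tree_at_in[OF wf, of "c + 1"] unfolding R_def by auto
    moreover have "c \<notin> tree_supp R" using g' calculation by (auto simp: Supp_def)
    ultimately show ?thesis using wfD(7)[of R] by auto
  qed
  have "wf_tree L" "wf_tree R" using L R wfD(3) by (metis wf_tree.simps(1))+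
  then show wfN: "wf_tree ?N" using L R g' by auto
  \<comment> \<open>Any other tree avoids \<open>c - 1\<close>, \<open>c\<close> and
    \<open>c + 1\<close>, hence lies wholly on one side of \<open>c\<close>; if there is a child on
    that side, the old gap to that child is the gap to the new tree.\<close>
  have sep: "hi_end T + 1 < lo_end ?N \<or> hi_end ?N + 1 < lo_end T" if T: "T \<in> F - {L, R}" for T
  proof -
    have TS: "tree_supp T = {lo_end T..hi_end T}" "lo_end T \<le> hi_end T"
      using wfD(7)[of T] lo_le_hi[OF wfD(4)[of T]] T by auto
    have "c - 1 \<notin> tree_supp T" "c + 1 \<notin> tree_supp T"
      using T tree_at_eq[OF wf, of T] unfolding L_def R_def by auto
    moreover have "c \<notin> tree_supp T" using g' T by (auto simp: Supp_def)
    ultimately consider "hi_end T < c - 1" | "c + 1 < lo_end T" using TS by (auto simp: not_le)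
    then show ?thesis
    proof cases
      case 1
      then show ?thesis using L hi_end_eq[of L] wfD(5)[of T L] T TS by (cases "L = Leaf") auto
    next
      case 2
      then show ?thesis using R hi_end_eq[of R] wfD(5)[of T R] T TS by (cases "R = Leaf") auto
    qed
  qed
  show "tree_supp T \<inter> tree_supp ?N = {}" if "T \<in> F - {L, R}" for T
    using sep[OF that] wfD(7)[of T] tree_supp_eq[OF wfN] that by (auto simp del: tree_supp_Node lo_end.simps hi_end.simps)
  show nodes: "forest_nodes (graft F L c a R) = insert ?N (forest_nodes F)"
    using L R unfolding forest_nodes_def graft_def by fastforce
  show "wf_forest (graft F L c a R)"
    unfolding wf_forest_def
  proof (intro conjI)
    show "inj_on root_letter (forest_nodes (graft F L c a R))"
      unfolding nodes using wfD(6) g'(2) by (auto intro: inj_onI dest: inj_onD)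
    show "\<forall>T\<in>graft F L c a R. \<forall>T'\<in>graft F L c a R. T \<noteq> T' \<longrightarrow>
        hi_end T + 1 < lo_end T' \<or> hi_end T' + 1 < lo_end T"
      using sep wfD(5) unfolding graft_def by blast
  qed (use wfD(1,2,3) wfN in \<open>auto simp: graft_def\<close>)
qed

text \<open>The three rules only differ in the label \<open>c\<close> of the new root; its children
  are always the trees next to \<open>c\<close>. The letter comparison with the tree containing
  \<open>val a\<close> is the case distinction itself. With any other neighbour it holds by values
  alone, because the value of a root letter lies in the block of its tree.\<close>

lemma insert_letter_eq_graft:
  assumes wf: "wf_forest F" and a: "a \<notin> root_letter ` forest_nodes F"
  shows "\<exists>c. graftable F c a \<and> insert_letter F a = graft F (tree_at F (c - 1)) c a (tree_at F (c + 1)) \<and>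
    (if val a \<notin> Supp F then c = val a
     else if a > root_letter (tree_at F (val a)) then c = Max (tree_supp (tree_at F (val a))) + 1
     else c = Min (tree_supp (tree_at F (val a))) - 1)"
proof (cases "val a \<in> Supp F")
  case False
  have "root_letter (tree_at F (val a - 1)) < a" if "tree_at F (val a - 1) \<noteq> Leaf"
  proof -
    let ?T = "tree_at F (val a - 1)"
    have T: "?T \<in> F" "val a - 1 \<in> tree_supp ?T" using that tree_at_ne_Leaf_iff[OF wf] tree_at_in[OF wf] by blast+
    have "val a \<notin> tree_supp ?T" using T False by (auto simp: Supp_def)
    then have "hi_end ?T = val a - 1" using T wf_forestD(7)[OF wf T(1)] by auto
    moreover have "val (root_letter ?T) \<le> hi_end ?T"
      using wf_forestD(3)[OF wf T(1)] that by (cases ?T rule: hi_end.cases) auto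
    ultimately show ?thesis by (simp add: less_zbar_def)
  qed
  moreover have "a < root_letter (tree_at F (val a + 1))" if "tree_at F (val a + 1) \<noteq> Leaf"
  proof -
    let ?T = "tree_at F (val a + 1)"
    have T: "?T \<in> F" "val a + 1 \<in> tree_supp ?T" using that tree_at_ne_Leaf_iff[OF wf] tree_at_in[OF wf] by blast+
    have "val a \<notin> tree_supp ?T" using T False by (auto simp: Supp_def)
    then have "lo_end ?T = val a + 1" using T wf_forestD(7)[OF wf T(1)] by auto
    moreover have "val (root_letter ?T) \<ge> lo_end ?T"
      using wf_forestD(3)[OF wf T(1)] that by (cases ?T rule: hi_end.cases) auto
    ultimately show ?thesis by (simp add: less_zbar_def)
  qed
  ultimately have "graftable F (val a) a" using False a by (auto simp: graftable_def Let_def)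
  then show ?thesis using False by (intro exI[of _ "val a"]) (simp add: insert_letter_def Let_def)
next
  case True
  define T where "T = tree_at F (val a)"
  have T: "T \<in> F" "val a \<in> tree_supp T" using tree_at_in[OF wf True] by (auto simp: T_def)
  have TS: "tree_supp T = {lo_end T..hi_end T}" "lo_end T \<le> hi_end T" "T \<noteq> Leaf"
    using wf_forestD(7)[OF wf T(1)] lo_le_hi[OF wf_forestD(4)[OF wf T(1)]] wf_forestD(4)[OF wf T(1)] by auto
  have MM: "Max (tree_supp T) = hi_end T" "Min (tree_supp T) = lo_end T"
    unfolding TS(1) using TS(2) by (auto intro!: Max_eqI Min_eqI)
  have out: "j \<notin> Supp F" if "j = hi_end T + 1 \<or> j = lo_end T - 1" for j
  proof
    assume "j \<in> Supp F"
    then obtain T' where T': "T' \<in> F" "j \<in> tree_supp T'" by (auto simp: Supp_def)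
    then have "T' \<noteq> T" using that TS by auto
    then show False using wf_forestD(5)[OF wf T'(1) T(1)] T'(2) wf_forestD(7)[OF wf T'(1)] that TS by auto
  qed
  have "T \<in> forest_nodes F" using T self_in_nodes[OF TS(3)] by (auto simp: forest_nodes_def)
  then have ne: "a \<noteq> root_letter T" using a by blast
  show ?thesis
  proof (cases "a > root_letter T")
    case gt: True
    let ?c = "hi_end T + 1"
    have L: "tree_at F (?c - 1) = T" using tree_at_eq[OF wf T(1)] TS by simp
    have R: "a < root_letter (tree_at F (?c + 1))" if "tree_at F (?c + 1) \<noteq> Leaf"
    proof -
      let ?T = "tree_at F (?c + 1)"
      have T': "?T \<in> F" "?c + 1 \<in> tree_supp ?T" using that tree_at_ne_Leaf_iff[OF wf] tree_at_in[OF wf] by blast+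
      have "?c \<notin> tree_supp ?T" using T' out by (auto simp: Supp_def)
      then have "lo_end ?T = ?c + 1" using T' wf_forestD(7)[OF wf T'(1)] by auto
      moreover have "val (root_letter ?T) \<ge> lo_end ?T"
        using wf_forestD(3)[OF wf T'(1)] that by (cases ?T rule: hi_end.cases) auto
      ultimately show ?thesis using T TS by (simp add: less_zbar_def)
    qed
    have "graftable F ?c a"
      unfolding graftable_def Let_def L
      using R gt a out T(2) TS hi_end_eq[OF TS(3)] by auto
    then show ?thesis using True gt L
      by (intro exI[of _ ?c]) (simp add: insert_letter_def Let_def T_def[symmetric] MM add.commute[of 2])
  next
    case False
    let ?c = "lo_end T - 1"
    have R: "tree_at F (?c + 1) = T" using tree_at_eq[OF wf T(1)] TS by simp
    have L: "root_letter (tree_at F (?c - 1)) < a" if "tree_at F (?c - 1) \<noteq> Leaf"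
    proof -
      let ?T = "tree_at F (?c - 1)"
      have T': "?T \<in> F" "?c - 1 \<in> tree_supp ?T" using that tree_at_ne_Leaf_iff[OF wf] tree_at_in[OF wf] by blast+
      have "?c \<notin> tree_supp ?T" using T' out by (auto simp: Supp_def)
      then have "hi_end ?T = ?c - 1" using T' wf_forestD(7)[OF wf T'(1)] by auto
      moreover have "val (root_letter ?T) \<le> hi_end ?T"
        using wf_forestD(3)[OF wf T'(1)] that by (cases ?T rule: hi_end.cases) auto
      ultimately show ?thesis using T TS by (simp add: less_zbar_def)
    qed
    have "a < root_letter T" using False ne by simp
    then have "graftable F ?c a"
      unfolding graftable_def Let_def R
      using L a out T(2) TS hi_end_eq[OF TS(3)] by auto
    then show ?thesis using True False R
      by (intro exI[of _ ?c]) (simp add: insert_letter_def Let_def T_def[symmetric] MM)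
  qed
qed

lemma P_forest_snoc: "P_forest (W @ [a]) = insert_letter (P_forest W) a"
  by (simp add: P_forest_def)

text \<open>The clause with \<open>last\<close> links the two algorithms: parking compares a letter
  with the last earlier one in the interval, insertion with the root of the tree there, and these
  are the same letter.\<close>

lemma P_forest_props:
  assumes "distinct W"
  shows "wf_forest (P_forest W) \<and> root_letter ` forest_nodes (P_forest W) = set W \<and>
    Omega W = Supp (P_forest W) \<and>
    (\<forall>T\<in>P_forest W. root_letter T = last (filter (\<lambda>b. val b \<in> tree_supp T) W)) \<and>
    W \<in> map root_letter ` lin_exts (forest_nodes (P_forest W)) ctr lo_end hi_end"
  using assms
proof (induction W rule: rev_induct)
  case Nil
  have "map root_letter [] \<in> map root_letter ` lin_exts (forest_nodes {}) ctr lo_end hi_end"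
    by (rule imageI) (simp add: lin_exts_def forest_nodes_def)
  then show ?case
    by (simp add: P_forest_def wf_forest_def forest_nodes_def Supp_def)
next
  case (snoc a W)
  let ?F = "P_forest W"
  have wf: "wf_forest ?F" and letters: "root_letter ` forest_nodes ?F = set W" and om: "Omega W = Supp ?F"
    and lst: "\<And>T. T \<in> ?F \<Longrightarrow> root_letter T = last (filter (\<lambda>b. val b \<in> tree_supp T) W)"
    and lin: "W \<in> map root_letter ` lin_exts (forest_nodes ?F) ctr lo_end hi_end"
    using snoc by auto
  have "a \<notin> root_letter ` forest_nodes ?F" using letters snoc.prems by simp
  from insert_letter_eq_graft[OF wf this] obtain c where c: "graftable ?F c a"
    "insert_letter ?F a = graft ?F (tree_at ?F (c - 1)) c a (tree_at ?F (c + 1))"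
    "if val a \<notin> Supp ?F then c = val a
     else if a > root_letter (tree_at ?F (val a)) then c = Max (tree_supp (tree_at ?F (val a))) + 1
     else c = Min (tree_supp (tree_at ?F (val a))) - 1" by blast
  define L R where "L = tree_at ?F (c - 1)" and "R = tree_at ?F (c + 1)"
  let ?N = "Node L (c, a) R"
  note gp = graft_props[OF wf c(1), folded L_def R_def]
  have P: "P_forest (W @ [a]) = graft ?F L c a R" by (simp add: P_forest_snoc c(2) L_def R_def)
  have cS: "c \<notin> Supp ?F" using c(1) by (simp add: graftable_def Let_def)
  have supp: "Supp (P_forest (W @ [a])) = insert c (Supp ?F)"
    unfolding P Supp_eq gp(2) by simp
  have "Omega (W @ [a]) = insert c (Supp ?F)"
  proof (cases "val a \<in> Supp ?F")
    case True
    let ?T = "tree_at ?F (val a)"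
    have T: "?T \<in> ?F" "val a \<in> tree_supp ?T" using tree_at_in[OF wf True] by auto
    have I: "max_interval (Supp ?F) (val a) = tree_supp ?T" by (rule max_interval_Supp[OF wf T])
    have "?T \<in> forest_nodes ?F" using T self_in_nodes wf_forestD(4)[OF wf T(1)] by (auto simp: forest_nodes_def)
    then have "a \<noteq> root_letter ?T" using letters snoc.prems by (metis distinct_append not_distinct_conv_prefix imageI)
    then have "a < root_letter ?T \<longleftrightarrow> \<not> a > root_letter ?T" by auto
    then show ?thesis using True c(3) by (auto simp: Omega_snoc om Let_def I lst[OF T(1), symmetric])
  next
    case False
    then show ?thesis using c(3) by (simp add: Omega_snoc om Let_def)
  qed
  then have om': "Omega (W @ [a]) = Supp (P_forest (W @ [a]))" using supp by simp
  \<comment> \<open>So \<open>a\<close> becomes the last letter in the block of the new tree, while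
    the blocks of the untouched trees are disjoint from it and keep their last letters.\<close>
  have va: "val a \<in> tree_supp ?N"
    using gp(3) tree_supp_eq[OF gp(3)] by (simp del: tree_supp_Node)
  have lst': "root_letter T = last (filter (\<lambda>b. val b \<in> tree_supp T) (W @ [a]))"
    if "T \<in> P_forest (W @ [a])" for T
  proof (cases "T = ?N")
    case True
    then show ?thesis using va by (simp del: tree_supp_Node)
  next
    case False
    then have T: "T \<in> ?F - {L, R}" using that P by (auto simp: graft_def)
    then have "val a \<notin> tree_supp T" using gp(4)[OF T] va by blast
    then show ?thesis using lst T by simp
  qed
  obtain ts where ts: "ts \<in> lin_exts (forest_nodes ?F) ctr lo_end hi_end" "W = map root_letter ts"
    using lin by blast
  interpret labeled_forest "forest_nodes ?F" ctr lo_end hi_end root_letter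
    by (rule labeled_forest_nodes[OF wf])
  \<comment> \<open>The new node is nobody's descendant in the old forest, so it may be appended at
    the end of the linear extension.\<close>
  have "c \<notin> {lo_end u..hi_end u}" if "u \<in> forest_nodes ?F" for u
    using full[OF that] cS by (auto simp: Supp_eq)
  moreover have "?N \<notin> forest_nodes ?F" using cS by (force simp: Supp_eq)
  ultimately have "ts @ [?N] \<in> lin_exts (forest_nodes (P_forest (W @ [a]))) ctr lo_end hi_end"
    using ts(1) unfolding P gp(2) by (auto simp: lin_exts_def sorted_wrt_append)
  then have "W @ [a] \<in> map root_letter ` lin_exts (forest_nodes (P_forest (W @ [a]))) ctr lo_end hi_end"
    using ts(2) by (intro image_eqI[of _ _ "ts @ [?N]"]) auto
  moreover have "root_letter ` forest_nodes (P_forest (W @ [a])) = set (W @ [a])"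
    unfolding P gp(2) using letters by simp
  moreover have "wf_forest (P_forest (W @ [a]))" unfolding P by (rule gp(1))
  ultimately show ?case using om' lst' by blast
qed

text \<open>The rule used by an insertion can be recovered from its result: the value of the root
  letter lies at \<open>c\<close>, in the left block or in the right block, and the letter order
  between root and child makes insertion choose the same \<open>c\<close> again.\<close>

lemma remove_root:
  assumes wf: "wf_forest F" and N: "Node L (c, a) R \<in> F"
  defines "F' \<equiv> (F - {Node L (c, a) R}) \<union> ({L, R} - {Leaf})"
  shows "wf_forest F'" "forest_nodes F' = forest_nodes F - {Node L (c, a) R}" "insert_letter F' a = F"
proof -
  let ?N = "Node L (c, a) R"
  note wfD = wf_forestD[OF wf]
  have wfN: "wf_tree L" "wf_tree R" "L \<noteq> Leaf \<Longrightarrow> hi_end L = c - 1 \<and> root_letter L < a"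
    "R \<noteq> Leaf \<Longrightarrow> lo_end R = c + 1 \<and> a < root_letter R" "val a \<in> {c - int (size L)..c + int (size R)}"
    using wfD(3)[OF N] by auto
  note S = tree_supp_children[OF wfD(3)[OF N]]
  have sep: "hi_end T + 1 < c - int (size L) \<or> c + int (size R) + 1 < lo_end T" if "T \<in> F - {?N}" for T
    using wfD(5)[OF N, of T] that by auto
  have le: "lo_end T \<le> hi_end T" if "T \<noteq> Leaf" for T using lo_le_hi[OF that] by simp
  have sL: "L \<noteq> Leaf \<Longrightarrow> lo_end L = c - int (size L)" using wfN hi_end_eq[of L] by auto
  have sR: "R \<noteq> Leaf \<Longrightarrow> hi_end R = c + int (size R)" using wfN hi_end_eq[of R] by auto
  \<comment> \<open>Grafting deletes \<open>L\<close> and \<open>R\<close> from the forest; this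
    must not remove a tree of \<open>F\<close> itself.\<close>
  have notin: "L \<notin> F - {?N}" "R \<notin> F - {?N}"
    using sep[of L] sep[of R] wfN sL sR le[of L] le[of R] wfD(2) by fastforce+
  have "?N \<notin> forest_nodes (F - {?N})"
  proof
    assume "?N \<in> forest_nodes (F - {?N})"
    then obtain T where that: "T \<in> F - {?N}" "?N \<in> nodes T" by (auto simp: forest_nodes_def)
    then have "c \<in> tree_supp T" by (force simp flip: ctr_image_nodes)
    then show False using sep[OF that(1)] wfD(7)[of T] that by auto
  qed
  moreover have "?N \<notin> nodes L" "?N \<notin> nodes R" using size_nodes[of ?N L] size_nodes[of ?N R] by auto
  moreover have "forest_nodes F = insert ?N (nodes L \<union> nodes R) \<union> forest_nodes (F - {?N})"
    using N unfolding forest_nodes_def nodes_Node[symmetric] by blast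
  moreover have "forest_nodes F' = nodes L \<union> nodes R \<union> forest_nodes (F - {?N})"
  proof -
    have "(\<Union>T\<in>{L, R} - {Leaf}. nodes T) = nodes L \<union> nodes R" by (cases L; cases R) (auto simp: insert_Diff_if)
    then show ?thesis unfolding forest_nodes_def F'_def by blast
  qed
  ultimately show fn: "forest_nodes F' = forest_nodes F - {?N}"
    by blast
  show wf': "wf_forest F'"
    unfolding wf_forest_def
  proof (intro conjI)
    show "inj_on root_letter (forest_nodes F')" unfolding fn by (rule inj_on_subset[OF wfD(6)]) auto
    have LR: "hi_end L + 1 < lo_end R" if "L \<noteq> Leaf" "R \<noteq> Leaf" using that wfN by simp
    have "hi_end T + 1 < lo_end L \<or> hi_end L + 1 < lo_end T" if "T \<in> F - {?N}" "L \<noteq> Leaf" for T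
      using sep[OF that(1)] that wfN sL by auto
    moreover have "hi_end T + 1 < lo_end R \<or> hi_end R + 1 < lo_end T" if "T \<in> F - {?N}" "R \<noteq> Leaf" for T
      using sep[OF that(1)] that wfN sR by auto
    ultimately show "\<forall>T\<in>F'. \<forall>T'\<in>F'. T \<noteq> T' \<longrightarrow> hi_end T + 1 < lo_end T' \<or> hi_end T' + 1 < lo_end T"
      using wfD(5) LR unfolding F'_def by blast
  qed (use wfD(1,2,3) wfN in \<open>auto simp: F'_def\<close>)
  have cs: "j \<notin> Supp F'" if "j = c \<or> (j = c - 1 \<and> L = Leaf) \<or> (j = c + 1 \<and> R = Leaf)" for j
  proof
    assume "j \<in> Supp F'"
    then obtain T where T: "T \<in> F'" "j \<in> tree_supp T" by (auto simp: Supp_def)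
    then consider "T \<in> F - {?N}" | "T = L" "L \<noteq> Leaf" | "T = R" "R \<noteq> Leaf" by (auto simp: F'_def)
    then show False
    proof cases
      case 1
      then show ?thesis using sep[of T] wfD(7)[of T] T(2) that by auto
    qed (use T(2) S that in auto)
  qed
  have atL: "tree_at F' (c - 1) = L"
  proof (cases "L = Leaf")
    case True
    then show ?thesis using cs by (simp add: tree_at_def)
  next
    case False
    then show ?thesis using S by (intro tree_at_eq[OF wf']) (auto simp: F'_def neq_Leaf_iff)
  qed
  have atR: "tree_at F' (c + 1) = R"
  proof (cases "R = Leaf")
    case True
    then show ?thesis using cs by (simp add: tree_at_def)
  next
    case False
    then show ?thesis using S by (intro tree_at_eq[OF wf']) (auto simp: F'_def neq_Leaf_iff)
  qed
  have gr: "graft F' L c a R = F"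
    using N notin wfD(2) unfolding graft_def F'_def by blast
  consider "val a = c" | "val a < c" | "c < val a" by linarith
  then have "insert_letter F' a = graft F' L c a R"
  proof cases
    case 1
    then show ?thesis using cs atL atR by (simp add: insert_letter_def Let_def)
  next
    case 2
    then have ne: "L \<noteq> Leaf" and v: "val a \<in> tree_supp L" using wfN(5) S by auto
    have "L \<in> F'" using ne by (simp add: F'_def)
    then have at: "tree_at F' (val a) = L" and i: "val a \<in> Supp F'"
      using tree_at_eq[OF wf'] v by (auto simp: Supp_def)
    have "Max (tree_supp L) = c - 1" using v unfolding S by (intro Max_eqI) auto
    then show ?thesis using at i atR wfN(3)[OF ne]
      by (simp add: insert_letter_def Let_def add.commute[of 1])
  next
    case 3
    then have ne: "R \<noteq> Leaf" and v: "val a \<in> tree_supp R" using wfN(5) S by auto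
    have "R \<in> F'" using ne by (simp add: F'_def)
    then have at: "tree_at F' (val a) = R" and i: "val a \<in> Supp F'"
      using tree_at_eq[OF wf'] v by (auto simp: Supp_def)
    have "Min (tree_supp R) = c + 1" using v unfolding S by (intro Min_eqI) auto
    moreover have "\<not> root_letter R < a" using wfN(4)[OF ne] by (simp add: less_imp_not_less)
    ultimately show ?thesis using at i atL by (simp add: insert_letter_def Let_def)
  qed
  then show "insert_letter F' a = F" using gr by simp
qed

lemma P_forest_lin_ext:
  assumes "wf_forest F" "ts \<in> lin_exts (forest_nodes F) ctr lo_end hi_end"
  shows "distinct (map root_letter ts) \<and> P_forest (map root_letter ts) = F"
  using assms
proof (induction ts arbitrary: F rule: rev_induct)
  case Nil
  then have "forest_nodes F = {}" by (simp add: lin_exts_def)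
  then have "F = {}" using self_in_nodes wf_forestD(4)[OF Nil.prems(1)] by (force simp: forest_nodes_def)
  then show ?case by (simp add: P_forest_def)
next
  case (snoc t ts)
  note wf = snoc.prems(1)
  have ts: "distinct ts" "t \<notin> set ts" "insert t (set ts) = forest_nodes F"
    "sorted_wrt (\<lambda>u v. ctr v \<notin> {lo_end u..hi_end u}) ts" "\<And>u. u \<in> set ts \<Longrightarrow> ctr t \<notin> {lo_end u..hi_end u}"
    using snoc.prems(2) by (auto simp: lin_exts_def sorted_wrt_append)
  then have tF: "t \<in> forest_nodes F" by blast
  then obtain T where T: "T \<in> F" "t \<in> nodes T" by (auto simp: forest_nodes_def)
  have TF: "T \<in> forest_nodes F" using T self_in_nodes wf_forestD(4)[OF wf] by (auto simp: forest_nodes_def)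
  \<comment> \<open>The last entry is a root: otherwise the root \<open>T\<close> above it would
    occur earlier, with \<open>t\<close> in its interval.\<close>
  have "t = T"
  proof (rule ccontr)
    assume "t \<noteq> T"
    then have "T \<in> set ts" using TF ts(3) by (metis insertE)
    then show False using ts(5) in_nodes_iff[OF wf TF tF] T by blast
  qed
  obtain L c a R where t: "t = Node L (c, a) R" using forest_nodes_ne_Leaf[OF wf tF] by (cases t) auto
  have N: "Node L (c, a) R \<in> F" using T \<open>t = T\<close> t by simp
  let ?F' = "(F - {Node L (c, a) R}) \<union> ({L, R} - {Leaf})"
  note rr = remove_root[OF wf N]
  have "set ts = forest_nodes F - {t}" using ts by auto
  then have "ts \<in> lin_exts (forest_nodes ?F') ctr lo_end hi_end"
    using ts rr(2) t by (simp add: lin_exts_def)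
  then have "P_forest (map root_letter ts) = ?F'" using snoc.IH[OF rr(1)] by blast
  then have "P_forest (map root_letter (ts @ [t])) = F" using rr(3) t by (simp add: P_forest_snoc)
  moreover have "distinct (map root_letter (ts @ [t]))"
    using ts wf_forestD(6)[OF wf] by (subst distinct_map) auto
  ultimately show ?case by blast
qed

lemma word_class_eq:
  assumes "wf_forest F"
  shows "{W. distinct W \<and> P_forest W = F} = map root_letter ` lin_exts (forest_nodes F) ctr lo_end hi_end"
  using P_forest_props P_forest_lin_ext[OF assms] by blast

subsection \<open>Divided symmetrization in the field of rational functions\<close>

definition act_term :: "(nat \<Rightarrow> nat) \<Rightarrow> (nat \<Rightarrow>\<^sub>0 nat) \<Rightarrow> ratpoly" where
  "act_term w m = (\<Prod>i\<in>Poly_Mapping.keys m. Xvar (w i) ^ Poly_Mapping.lookup m i)"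

lemma act_term_superset:
  assumes "finite S" "Poly_Mapping.keys m \<subseteq> S"
  shows "act_term w m = (\<Prod>i\<in>S. Xvar (w i) ^ Poly_Mapping.lookup m i)"
  unfolding act_term_def by (rule prod.mono_neutral_left) (use assms in \<open>auto simp: in_keys_iff\<close>)

lemma act_term_add: "act_term w (m + m') = act_term w m * act_term w m'"
proof -
  let ?S = "Poly_Mapping.keys m \<union> Poly_Mapping.keys m'"
  have "Poly_Mapping.keys (m + m') \<subseteq> ?S" by (rule Poly_Mapping.keys_add)
  then show ?thesis
    by (simp add: act_term_superset[of ?S] lookup_add power_add prod.distrib)
qed

lemma act_superset:
  assumes "finite S" "Poly_Mapping.keys f \<subseteq> S"
  shows "act w f = (\<Sum>m\<in>S. Poly_Mapping.single 0 (Poly_Mapping.lookup f m) * act_term w m)"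
  unfolding act_def act_term_def[symmetric]
  by (rule sum.mono_neutral_left) (use assms in \<open>auto simp: in_keys_iff\<close>)

lemma act_add: "act w (f + g) = act w f + act w g"
proof -
  let ?S = "Poly_Mapping.keys f \<union> Poly_Mapping.keys g"
  have "Poly_Mapping.keys (f + g) \<subseteq> ?S" by (rule Poly_Mapping.keys_add)
  then show ?thesis
    by (simp add: act_superset[of ?S] lookup_add single_add distrib_right sum.distrib)
qed

lemma act_zero: "act w 0 = 0"
  by (simp add: act_def)

lemma act_diff: "act w (f - g) = act w f - act w g"
  using act_add[of w "f - g" g] by simp

lemma act_sum: "act w (\<Sum>i\<in>I. f i) = (\<Sum>i\<in>I. act w (f i))"
  by (induction I rule: infinite_finite_induct) (auto simp: act_zero act_add)

lemma act_single: "act w (Poly_Mapping.single m c) = Poly_Mapping.single 0 c * act_term w m"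
  by (subst act_superset[of "{m}"]) auto

lemma sum_single_lookup:
  "(\<Sum>m\<in>Poly_Mapping.keys f. Poly_Mapping.single m (Poly_Mapping.lookup f m)) = f"
  by (rule poly_mapping_eqI) (auto simp: lookup_sum lookup_single when_def in_keys_iff sum.delta)

lemma act_mult: "act w (f * g) = act w f * act w g"
proof -
  have "f * g = (\<Sum>m\<in>Poly_Mapping.keys f. \<Sum>m'\<in>Poly_Mapping.keys g.
      Poly_Mapping.single m (Poly_Mapping.lookup f m) * Poly_Mapping.single m' (Poly_Mapping.lookup g m'))"
    by (subst (1) sum_single_lookup[of f, symmetric], subst (1) sum_single_lookup[of g, symmetric]) (simp only: sum_product)
  then have "act w (f * g) = (\<Sum>m\<in>Poly_Mapping.keys f. \<Sum>m'\<in>Poly_Mapping.keys g.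
      Poly_Mapping.single 0 (Poly_Mapping.lookup f m * Poly_Mapping.lookup g m') * act_term w (m + m'))"
    by (simp only: act_sum mult_single act_single)
  also have "\<dots> = (\<Sum>m\<in>Poly_Mapping.keys f. \<Sum>m'\<in>Poly_Mapping.keys g.
      (Poly_Mapping.single 0 (Poly_Mapping.lookup f m) * act_term w m) *
      (Poly_Mapping.single 0 (Poly_Mapping.lookup g m') * act_term w m'))"
  proof (intro sum.cong refl)
    fix m m'
    have "Poly_Mapping.single 0 (Poly_Mapping.lookup f m * Poly_Mapping.lookup g m') =
      (Poly_Mapping.single 0 (Poly_Mapping.lookup f m) * Poly_Mapping.single 0 (Poly_Mapping.lookup g m') :: ratpoly)"
      by (simp add: mult_single)
    then show "Poly_Mapping.single 0 (Poly_Mapping.lookup f m * Poly_Mapping.lookup g m') * act_term w (m + m') =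
      (Poly_Mapping.single 0 (Poly_Mapping.lookup f m) * act_term w m) *
      (Poly_Mapping.single 0 (Poly_Mapping.lookup g m') * act_term w m')"
      by (simp add: act_term_add ac_simps)
  qed
  also have "\<dots> = act w f * act w g"
    by (simp only: act_def act_term_def sum_product)
  finally show ?thesis .
qed

lemma act_one: "act w 1 = 1"
  using act_single[of w 0 1] by (simp add: act_term_def)

lemma act_prod: "act w (\<Prod>i\<in>I. f i) = (\<Prod>i\<in>I. act w (f i))"
  by (induction I rule: infinite_finite_induct) (auto simp: act_one act_mult)

section \<open>From rational functions to sums over orderings of the variables\<close>

definition frac_of :: "ratpoly \<Rightarrow> ratpoly fract" where
  "frac_of p = Fract p 1"

lemma frac_of_add: "frac_of (p + q) = frac_of p + frac_of q"
  by (simp add: frac_of_def)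

lemma frac_of_mult: "frac_of (p * q) = frac_of p * frac_of q"
  by (simp add: frac_of_def)

lemma frac_of_diff: "frac_of (p - q) = frac_of p - frac_of q"
  by (simp add: frac_of_def)

lemma frac_of_sum: "frac_of (\<Sum>i\<in>I. f i) = (\<Sum>i\<in>I. frac_of (f i))"
  by (induction I rule: infinite_finite_induct) (auto simp: frac_of_add, auto simp: frac_of_def Zero_fract_def)

lemma frac_of_prod: "frac_of (\<Prod>i\<in>I. f i) = (\<Prod>i\<in>I. frac_of (f i))"
  by (induction I rule: infinite_finite_induct) (auto simp: frac_of_mult, auto simp: frac_of_def One_fract_def)

lemma Fract_eq_divide: "Fract p q = frac_of p / frac_of q"
  by (simp add: frac_of_def)

lemma Xvar_eq_iff: "Xvar i = Xvar j \<longleftrightarrow> i = j"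
  unfolding Xvar_def by (metis lookup_single_eq lookup_single_not_eq zero_neq_one)

lemma inj_frac_of_Xvar: "inj (\<lambda>i. frac_of (Xvar i))"
  by (rule injI) (simp add: frac_of_def eq_fract Xvar_eq_iff)

lemma sum_permutes_eq_permutations_of_set:
  assumes inj: "inj_on x {1..n}"
  shows "(\<Sum>w | w permutes {1..n}. h (map (\<lambda>i. x (w i)) [1..<Suc n])) =
    (\<Sum>xs\<in>permutations_of_set (x ` {1..n}). h xs)"
proof -
  let ?m = "\<lambda>w. map (\<lambda>i. x (w i)) [1..<Suc n]"
  let ?P = "{w. w permutes {1..n}}"
  have inj_m: "inj_on ?m ?P"
  proof (rule inj_onI)
    fix v w assume vw: "v \<in> ?P" "w \<in> ?P" "?m v = ?m w"
    have "v i = w i" for i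
    proof (cases "i \<in> {1..n}")
      case True
      then have "i \<in> set [1..<Suc n]" by auto
      then have "x (v i) = x (w i)" using vw(3) by (meson map_eq_conv)
      moreover have "v i \<in> {1..n}" "w i \<in> {1..n}"
        using True vw(1,2) permutes_in_image by (metis mem_Collect_eq)+
      ultimately show ?thesis using inj by (auto dest: inj_onD)
    next
      case False
      then show ?thesis using vw(1,2) by (simp add: permutes_not_in)
    qed
    then show "v = w" by blast
  qed
  have "?m ` ?P = permutations_of_set (x ` {1..n})"
  proof (rule card_subset_eq)
    show "?m ` ?P \<subseteq> permutations_of_set (x ` {1..n})"
    proof
      fix xs assume "xs \<in> ?m ` ?P"
      then obtain w where w: "w permutes {1..n}" "xs = ?m w" by auto
      have S: "set [1..<Suc n] = {1..n}" by auto
      have "set xs = x ` w ` {1..n}" unfolding w(2) set_map S by (simp add: image_image)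
      then have "set xs = x ` {1..n}" using permutes_image[OF w(1)] by simp
      moreover have "inj_on (\<lambda>i. x (w i)) {1..n}"
        using inj permutes_inj_on[OF w(1)] permutes_image[OF w(1)] by (intro comp_inj_on[of w _ x, unfolded comp_def]) auto
      then have "distinct xs" unfolding w(2) distinct_map S by simp
      ultimately show "xs \<in> permutations_of_set (x ` {1..n})" by (intro permutations_of_setI)
    qed
    have "card (?m ` ?P) = fact n" using inj_m by (simp add: card_image card_permutations)
    then show "card (?m ` ?P) = card (permutations_of_set (x ` {1..n}))"
      using inj by (simp add: card_image)
  qed simp
  then show ?thesis using sum.reindex[OF inj_m, of h] by (simp add: comp_def)
qed

lemma diff_prod_map_upt:
  "diff_prod (map y [a..<a + Suc n]) = (\<Prod>i=a..<a + n. y i - y (Suc i))"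
proof (induction n arbitrary: a)
  case (Suc n)
  have "[a..<a + Suc (Suc n)] = a # [Suc a..<Suc a + Suc n]" by (simp add: upt_rec)
  moreover have "hd [Suc a..<Suc a + Suc n] = Suc a" by (simp del: upt_Suc)
  ultimately have "diff_prod (map y [a..<a + Suc (Suc n)]) = (y a - y (Suc a)) * diff_prod (map y [Suc a..<Suc a + Suc n])"
    by (simp add: diff_prod_Cons hd_map del: upt_Suc)
  then show ?case unfolding Suc.IH by (simp add: prod.atLeast_Suc_lessThan)
qed simp

text \<open>A permutation \<open>w\<close> corresponds to the list of variables
  \<open>w 1, ..., w n\<close>. The indices must stay in \<open>{1..n}\<close> because
  \<open>coord\<close> carries no information beyond the length of that list.\<close>

lemma DS_eq_dsym:
  fixes a :: "'i \<Rightarrow> nat list"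
  assumes n: "n \<ge> 1" and a: "\<And>i. i \<in> I \<Longrightarrow> set (a i) \<subseteq> {1..n}"
  shows "DS n (\<Sum>i\<in>I. \<Prod>j<length (a i). Xvar (a i ! j)) =
    dsym ((\<lambda>i. frac_of (Xvar i)) ` {1..n}) (\<lambda>z. \<Sum>i\<in>I. \<Prod>j<length (a i). z (a i ! j))"
proof -
  let ?x = "\<lambda>i. frac_of (Xvar i)"
  let ?f = "\<Sum>i\<in>I. \<Prod>j<length (a i). Xvar (a i ! j)"
  let ?g = "\<lambda>z. \<Sum>i\<in>I. \<Prod>j<length (a i). z (a i ! j)"
  obtain k where k: "n = Suc k" using n by (cases n) auto
  have "Fract (act w ?f) (act w (\<Prod>i = 1..n - 1. Xvar i - Xvar (i + 1))) =
    ?g (coord (map (\<lambda>i. ?x (w i)) [1..<Suc n])) / diff_prod (map (\<lambda>i. ?x (w i)) [1..<Suc n])" for w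
  proof -
    have "frac_of (act w ?f) = (\<Sum>i\<in>I. \<Prod>j<length (a i). ?x (w (a i ! j)))"
      by (simp add: act_sum act_prod frac_of_sum frac_of_prod)
    also have "\<dots> = ?g (coord (map (\<lambda>i. ?x (w i)) [1..<Suc n]))"
    proof (intro sum.cong prod.cong refl)
      fix i j assume "i \<in> I" "j \<in> {..<length (a i)}"
      then have "a i ! j \<in> {1..n}" using a nth_mem by blast
      then show "?x (w (a i ! j)) = coord (map (\<lambda>i. ?x (w i)) [1..<Suc n]) (a i ! j)"
        by (subst coord_def, subst nth_map) (auto simp del: upt_Suc simp: nth_upt)
    qed
    finally have num: "frac_of (act w ?f) = ?g (coord (map (\<lambda>i. ?x (w i)) [1..<Suc n]))" .
    have "frac_of (act w (\<Prod>i = 1..n - 1. Xvar i - Xvar (i + 1))) = (\<Prod>i=1..n - 1. ?x (w i) - ?x (w (Suc i)))"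
      by (simp add: act_prod act_diff frac_of_prod frac_of_diff)
    also have "\<dots> = diff_prod (map (\<lambda>i. ?x (w i)) [1..<Suc n])"
      using diff_prod_map_upt[of "\<lambda>i. ?x (w i)" 1 k] k by (simp add: atLeastLessThanSuc_atLeastAtMost del: upt_Suc)
    finally show ?thesis unfolding Fract_eq_divide num by simp
  qed
  then show ?thesis
    unfolding DS_def dsym_def
    using sum_permutes_eq_permutations_of_set[of ?x n "\<lambda>xs. ?g (coord xs) / diff_prod xs"]
      inj_on_subset[OF inj_frac_of_Xvar] by simp
qed

theorem theorem5p11:
  fixes n :: nat and A :: "zbar list set"
  assumes "n \<ge> 1"
    and "finite A"
    and "\<And>W. W \<in> A \<Longrightarrow> distinct W"
    and "\<And>W. W \<in> A \<Longrightarrow> length W = n - 1"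
    and "\<And>W a. W \<in> A \<Longrightarrow> a \<in> set W \<Longrightarrow> val a \<in> {1..int n}"
    and "\<And>W W'. W \<in> A \<Longrightarrow> distinct W' \<Longrightarrow> word_equiv W W' \<Longrightarrow> W' \<in> A"
  shows "DS n (\<Sum>W\<in>A. slide W) = of_nat (card {W \<in> A. Omega_parking W})"
proof -
  let ?x = "\<lambda>i. frac_of (Xvar i)"
  let ?X = "?x ` {1..n}"
  let ?s = "\<lambda>W z. \<Sum>a\<in>slide_seqs W. \<Prod>j<length W. z (a ! j) :: ratpoly fract"
  let ?lin = "\<lambda>F. lin_exts (forest_nodes F) ctr lo_end hi_end"
  have X: "finite ?X" "card ?X = n"
    using inj_on_subset[OF inj_frac_of_Xvar] by (auto simp: card_image)
  have inf: "infinite (UNIV :: ratpoly fract set)"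
    using inj_frac_of_Xvar infinite_UNIV_char_0[where 'a = nat] finite_imageD[of ?x UNIV]
      finite_subset[OF subset_UNIV[of "range ?x"]] by auto
  have seqs: "set a \<subseteq> {1..n} \<and> length a = length W" if "W \<in> A" "a \<in> slide_seqs W" for W a
  proof -
    have "a ! j \<in> {1..n}" if "j < length W" for j
      using that \<open>a \<in> slide_seqs W\<close> assms(5)[OF \<open>W \<in> A\<close>, of "W ! j"] by (fastforce simp: slide_seqs_def)
    then show ?thesis using that(2) by (auto simp: slide_seqs_def in_set_conv_nth)
  qed
  \<comment> \<open>Stability makes \<open>A\<close> a union of complete classes, each of which is
    the set of linear extensions of its forest.\<close>
  have cls: "{W \<in> A. P_forest W = F} = map root_letter ` ?lin F" "wf_forest F" if F: "F \<in> P_forest ` A" for F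
  proof -
    obtain W0 where W0: "W0 \<in> A" "F = P_forest W0" using F by blast
    show "wf_forest F" using P_forest_props[OF assms(3)[OF W0(1)]] W0(2) by blast
    then have "{W. distinct W \<and> P_forest W = F} = map root_letter ` ?lin F" by (rule word_class_eq)
    moreover have "{W \<in> A. P_forest W = F} = {W. distinct W \<and> P_forest W = F}"
    proof (intro set_eqI iffI)
      fix W assume "W \<in> {W. distinct W \<and> P_forest W = F}"
      then show "W \<in> {W \<in> A. P_forest W = F}"
        using assms(6)[OF W0(1), of W] W0(2) by (simp add: word_equiv_def)
    qed (use assms(3) in blast)
    ultimately show "{W \<in> A. P_forest W = F} = map root_letter ` ?lin F" by simp
  qed
  have one: "dsym ?X (\<lambda>z. \<Sum>W | W \<in> A \<and> P_forest W = F. ?s W z) =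
    of_nat (card {W \<in> A. P_forest W = F \<and> Omega_parking W})" if F: "F \<in> P_forest ` A" for F
  proof -
    note wf = cls(2)[OF F]
    interpret labeled_forest "forest_nodes F" ctr lo_end hi_end root_letter
      by (rule labeled_forest_nodes[OF wf])
    obtain W0 where W0: "W0 \<in> A" "F = P_forest W0" using F by blast
    have letters: "root_letter ` forest_nodes F = set W0"
      using P_forest_props[OF assms(3)[OF W0(1)]] W0(2) by blast
    have card: "Suc (card (forest_nodes F)) = n"
    proof -
      have "card (forest_nodes F) = card (set W0)" using card_image[OF inj_l] letters by simp
      also have "\<dots> = n - 1" using assms(3,4) W0 by (simp add: distinct_card)
      finally show ?thesis using assms(1) by simp
    qed
    \<comment> \<open>The bound on the letters of \<open>A\<close> passes to the left ends, since
      the value of a letter lies in the interval of its node.\<close>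
    have bound: "lo_end u \<le> int (Suc (card (forest_nodes F)))" if u: "u \<in> forest_nodes F" for u
    proof -
      have "val (root_letter u) \<le> int n" using assms(5)[OF W0(1)] letters u by force
      then show ?thesis using val_l[OF u] card by simp
    qed
    have inj: "inj_on (map root_letter) (?lin F)"
    proof (rule inj_onI)
      fix ts ts' assume "ts \<in> ?lin F" "ts' \<in> ?lin F" "map root_letter ts = map root_letter ts'"
      then show "ts = ts'" using inj_l by (simp add: lin_exts_def inj_on_map_eq_map)
    qed
    \<comment> \<open>Parking is a property of the class: \<open>\<Omega>\<close> of a word is the
      support of its forest, and all words in \<open>A\<close> have the same length.\<close>
    have parking: "ctr ` forest_nodes F = {1..int (card (forest_nodes F))} \<longleftrightarrow> Omega_parking W"
      if "W \<in> A" "P_forest W = F" for W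
      using P_forest_props[OF assms(3)[OF that(1)]] that assms(4)[OF that(1)] card
      by (auto simp: Omega_parking_def Supp_eq)
    have "(\<Sum>W | W \<in> A \<and> P_forest W = F. ?s W z) = forest_poly (forest_nodes F) ctr lo_end hi_end lo_end z" for z
      unfolding cls(1)[OF F, simplified] sum_slides_eq_forest_poly[symmetric]
      by (subst sum.reindex[OF inj]) simp
    then have "dsym ?X (\<lambda>z. \<Sum>W | W \<in> A \<and> P_forest W = F. ?s W z) =
      dsym ?X (forest_poly (forest_nodes F) ctr lo_end hi_end lo_end)" by simp
    also have "\<dots> = (if ctr ` forest_nodes F = {1..int (card (forest_nodes F))} then of_nat (card (?lin F)) else 0)"
      using card X bound by (intro dsym_forest_poly inf) (auto intro: indexed_forest_axioms)
    also have "card (?lin F) = card {W \<in> A. P_forest W = F}"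
      using cls(1)[OF F] card_image[OF inj] by simp
    also have "(if ctr ` forest_nodes F = {1..int (card (forest_nodes F))} then of_nat (card {W \<in> A. P_forest W = F}) else 0)
      = (of_nat (card {W \<in> A. P_forest W = F \<and> Omega_parking W}) :: ratpoly fract)"
    proof (cases "ctr ` forest_nodes F = {1..int (card (forest_nodes F))}")
      case True
      then have "{W \<in> A. P_forest W = F} = {W \<in> A. P_forest W = F \<and> Omega_parking W}"
        using parking by blast
      then show ?thesis using True by simp
    next
      case False
      then have "{W \<in> A. P_forest W = F \<and> Omega_parking W} = {}" using parking by blast
      then show ?thesis by (simp only: False if_False card.empty of_nat_0)
    qed
    finally show ?thesis .
  qed
  let ?I = "Sigma A slide_seqs"
  have sub: "set (snd p) \<subseteq> {1..n}" if "p \<in> ?I" for p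
    by (rule SigmaE[OF that]) (use seqs in simp)
  have "(\<Sum>W\<in>A. slide W) = (\<Sum>p\<in>?I. \<Prod>j<length (snd p). Xvar (snd p ! j))"
  proof -
    have "(\<Sum>W\<in>A. slide W) = (\<Sum>W\<in>A. \<Sum>a\<in>slide_seqs W. \<Prod>j<length a. Xvar (a ! j))"
      unfolding slide_def using seqs by (intro sum.cong prod.cong refl) auto
    then show ?thesis using assms(2) finite_slide_seqs by (simp add: sum.Sigma case_prod_unfold)
  qed
  then have "DS n (\<Sum>W\<in>A. slide W) = dsym ?X (\<lambda>z. \<Sum>p\<in>?I. \<Prod>j<length (snd p). z (snd p ! j))"
    by (simp only: DS_eq_dsym[OF assms(1) sub])
  also have "\<dots> = dsym ?X (\<lambda>z. \<Sum>W\<in>A. ?s W z)"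
  proof -
    have "(\<Sum>p\<in>?I. \<Prod>j<length (snd p). z (snd p ! j)) = (\<Sum>W\<in>A. ?s W z)" for z :: "nat \<Rightarrow> ratpoly fract"
    proof -
      have "(\<Sum>W\<in>A. ?s W z) = (\<Sum>W\<in>A. \<Sum>a\<in>slide_seqs W. \<Prod>j<length a. z (a ! j))"
        using seqs by (intro sum.cong prod.cong refl) auto
      then show ?thesis using assms(2) finite_slide_seqs by (simp add: sum.Sigma case_prod_unfold)
    qed
    then show ?thesis by simp
  qed
  also have "\<dots> = dsym ?X (\<lambda>z. \<Sum>F\<in>P_forest ` A. \<Sum>W | W \<in> A \<and> P_forest W = F. ?s W z)"
    by (subst sum.image_gen[OF assms(2), of _ P_forest]) simp
  also have "\<dots> = (\<Sum>F\<in>P_forest ` A. of_nat (card {W \<in> A. P_forest W = F \<and> Omega_parking W}))"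
    unfolding dsym_sum[of _ _ "P_forest ` A"] using one by simp
  also have "\<dots> = of_nat (\<Sum>F\<in>P_forest ` A. card {W \<in> A. P_forest W = F \<and> Omega_parking W})"
    by simp
  also have "(\<Sum>F\<in>P_forest ` A. card {W \<in> A. P_forest W = F \<and> Omega_parking W}) =
      card (\<Union>F\<in>P_forest ` A. {W \<in> A. P_forest W = F \<and> Omega_parking W})"
    using assms(2) by (intro card_UN_disjoint[symmetric]) auto
  also have "(\<Union>F\<in>P_forest ` A. {W \<in> A. P_forest W = F \<and> Omega_parking W}) = {W \<in> A. Omega_parking W}"
    by auto
  finally show ?thesis .
qed

end
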